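(* Let $E$ be a Banach space and let $B_w$ denote the closed unit ball of $E$ endowed with (the restriction of) the weak topology $\sigma(E,E')$. Then $B_w$ has the Pytkeev property if and only if $E$ (with the norm topology) contains no isomorphic copy of $\ell_1$.
   Context: $E'$ denotes the topological dual of $E$. A topological space $X$ has the Pytkeev property if for any $A\subset X$ and each $x\in\overline{A}\setminus A$ there are infinite subsets $A_1,A_2,\dots$ of $A$ such that each neighborhood of $x$ contains some $A_n$. *)

theory Defs
  imports "HOL-Analysis.Analysis"
begin

text \<open>All vector spaces are over the reals, and \<^typ>\<open>'a \<Rightarrow>\<^sub>L real\<close> is the topological dual of \<open>'a\<close>.\<close>

definition weak_topology :: "'a::real_normed_vector topology" where
  "weak_topology = topology_generated_by
     {blinfun_apply f -` U | (f :: 'a \<Rightarrow>\<^sub>L real) U. open U}"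

lemma topspace_weak_topology [simp]: "topspace weak_topology = UNIV"
proof -
  have "UNIV \<in> {blinfun_apply f -` U | (f :: 'a \<Rightarrow>\<^sub>L real) U. open U}"
    by (rule CollectI, intro exI[of _ 0] exI[of _ UNIV]) auto
  then show ?thesis
    unfolding weak_topology_def topology_generated_by_topspace by blast
qed

definition Pytkeev_space :: "'a topology \<Rightarrow> bool" where
  "Pytkeev_space X \<longleftrightarrow>
     (\<forall>A x. A \<subseteq> topspace X \<longrightarrow> x \<in> X closure_of A - A \<longrightarrow>
        (\<exists>B :: nat \<Rightarrow> 'a set.
           (\<forall>n. infinite (B n) \<and> B n \<subseteq> A) \<and>
           (\<forall>N. N \<subseteq> topspace X \<longrightarrow> (\<exists>U. openin X U \<and> x \<in> U \<and> U \<subseteq> N) \<longrightarrow> (\<exists>n. B n \<subseteq> N))))"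

typedef l1 = "{x :: nat \<Rightarrow> real. summable (\<lambda>n. \<bar>x n\<bar>)}"
  morphisms l1_nth Abs_l1
  by (rule exI[of _ "\<lambda>_. 0"]) simp

setup_lifting type_definition_l1

lemma summable_l1_nth: "summable (\<lambda>n. \<bar>l1_nth x n\<bar>)"
  using l1_nth[of x] by simp

lemma summable_abs_add:
  fixes x y :: "nat \<Rightarrow> real"
  assumes "summable (\<lambda>n. \<bar>x n\<bar>)" "summable (\<lambda>n. \<bar>y n\<bar>)"
  shows "summable (\<lambda>n. \<bar>x n + y n\<bar>)"
  by (rule summable_comparison_test'[OF summable_add[OF assms], of 0]) (simp add: abs_triangle_ineq)

lemma summable_abs_diff:
  fixes x y :: "nat \<Rightarrow> real"
  assumes "summable (\<lambda>n. \<bar>x n\<bar>)" "summable (\<lambda>n. \<bar>y n\<bar>)"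
  shows "summable (\<lambda>n. \<bar>x n - y n\<bar>)"
  using summable_abs_add[of x "\<lambda>n. - y n"] assms by simp

instantiation l1 :: real_normed_vector
begin

lift_definition zero_l1 :: l1 is "\<lambda>_. 0"
  by simp

lift_definition plus_l1 :: "l1 \<Rightarrow> l1 \<Rightarrow> l1" is "\<lambda>x y n. x n + y n"
  by (rule summable_abs_add)

lift_definition minus_l1 :: "l1 \<Rightarrow> l1 \<Rightarrow> l1" is "\<lambda>x y n. x n - y n"
  by (rule summable_abs_diff)

lift_definition uminus_l1 :: "l1 \<Rightarrow> l1" is "\<lambda>x n. - x n"
  by simp

lift_definition scaleR_l1 :: "real \<Rightarrow> l1 \<Rightarrow> l1" is "\<lambda>c x n. c * x n"
  by (simp add: abs_mult summable_mult)

lift_definition norm_l1 :: "l1 \<Rightarrow> real" is "\<lambda>x. \<Sum>n. \<bar>x n\<bar>" .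

definition "sgn (x :: l1) = inverse (norm x) *\<^sub>R x"
definition "dist (x :: l1) y = norm (x - y)"
definition "uniformity = (INF e\<in>{0<..}. principal {(x :: l1, y). dist x y < e})"
definition "open (U :: l1 set) \<longleftrightarrow>
  (\<forall>x\<in>U. eventually (\<lambda>(x', y). x' = x \<longrightarrow> y \<in> U) uniformity)"

instance
proof
  fix a b :: real and x y z :: l1
  show "x + y + z = x + (y + z)" "x + y = y + x" "0 + x = x" "- x + x = 0" "x - y = x + - y"
    "a *\<^sub>R (x + y) = a *\<^sub>R x + a *\<^sub>R y" "(a + b) *\<^sub>R x = a *\<^sub>R x + b *\<^sub>R x"
    "a *\<^sub>R b *\<^sub>R x = (a * b) *\<^sub>R x" "1 *\<^sub>R x = x"
    by (transfer; simp add: algebra_simps fun_eq_iff)+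
  show "(norm x = 0) = (x = 0)"
    by transfer (simp add: suminf_eq_zero_iff fun_eq_iff)
  show "norm (x + y) \<le> norm x + norm y"
  proof transfer
    fix x y :: "nat \<Rightarrow> real"
    assume s: "summable (\<lambda>n. \<bar>x n\<bar>)" "summable (\<lambda>n. \<bar>y n\<bar>)"
    have "(\<Sum>n. \<bar>x n + y n\<bar>) \<le> (\<Sum>n. \<bar>x n\<bar> + \<bar>y n\<bar>)"
      by (rule suminf_le[OF abs_triangle_ineq _ summable_add[OF s]],
          rule summable_abs_add[OF s])
    then show "(\<Sum>n. \<bar>x n + y n\<bar>) \<le> (\<Sum>n. \<bar>x n\<bar>) + (\<Sum>n. \<bar>y n\<bar>)"
      by (simp add: suminf_add[OF s])
  qed
  show "norm (a *\<^sub>R x) = \<bar>a\<bar> * norm x"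
    by transfer (simp add: abs_mult suminf_mult)
qed (simp_all add: sgn_l1_def dist_l1_def uniformity_l1_def open_l1_def)

end

lemma sum_le_norm_l1: "(\<Sum>n<K. \<bar>l1_nth x n\<bar>) \<le> norm x"
  unfolding norm_l1.rep_eq by (rule sum_le_suminf[OF summable_l1_nth]) auto

lemma abs_l1_nth_le_norm: "\<bar>l1_nth x n\<bar> \<le> norm x"
proof -
  have "\<bar>l1_nth x n\<bar> \<le> (\<Sum>k<Suc n. \<bar>l1_nth x k\<bar>)"
    by (simp add: sum_nonneg)
  with sum_le_norm_l1[of x "Suc n"] show ?thesis by linarith
qed

instance l1 :: banach
proof
  fix X :: "nat \<Rightarrow> l1"
  assume X: "Cauchy X"
  have "Cauchy (\<lambda>n. l1_nth (X n) k)" for k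
  proof (rule metric_CauchyI)
    fix e :: real assume "e > 0"
    then obtain M where M: "\<And>m n. m \<ge> M \<Longrightarrow> n \<ge> M \<Longrightarrow> norm (X m - X n) < e"
      using CauchyD[OF X] by blast
    have "dist (l1_nth (X m) k) (l1_nth (X n) k) < e" if "m \<ge> M" "n \<ge> M" for m n
      using M[OF that] abs_l1_nth_le_norm[of "X m - X n" k]
      by (simp add: dist_real_def minus_l1.rep_eq)
    then show "\<exists>M. \<forall>m\<ge>M. \<forall>n\<ge>M. dist (l1_nth (X m) k) (l1_nth (X n) k) < e" by blast
  qed
  then have "\<forall>k. \<exists>l. (\<lambda>n. l1_nth (X n) k) \<longlonglongrightarrow> l"
    by (simp add: Cauchy_convergent_iff convergent_def)
  then obtain a where a: "\<And>k. (\<lambda>n. l1_nth (X n) k) \<longlonglongrightarrow> a k" by metis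
  have tail: "\<exists>M. \<forall>m\<ge>M. \<forall>K. (\<Sum>k<K. \<bar>l1_nth (X m) k - a k\<bar>) \<le> e" if e: "e > 0" for e
  proof -
    obtain M where M: "\<And>m n. m \<ge> M \<Longrightarrow> n \<ge> M \<Longrightarrow> norm (X m - X n) < e"
      using CauchyD[OF X e] by blast
    have "(\<Sum>k<K. \<bar>l1_nth (X m) k - a k\<bar>) \<le> e" if m: "m \<ge> M" for m K
    proof (rule LIMSEQ_le_const2)
      show "(\<lambda>n. \<Sum>k<K. \<bar>l1_nth (X m) k - l1_nth (X n) k\<bar>)
              \<longlonglongrightarrow> (\<Sum>k<K. \<bar>l1_nth (X m) k - a k\<bar>)"
        by (intro tendsto_intros a)
      have "(\<Sum>k<K. \<bar>l1_nth (X m) k - l1_nth (X n) k\<bar>) \<le> e" if "n \<ge> M" for n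
        using sum_le_norm_l1[of "X m - X n" K] M[OF m that] by (simp add: minus_l1.rep_eq)
      then show "\<exists>N. \<forall>n\<ge>N. (\<Sum>k<K. \<bar>l1_nth (X m) k - l1_nth (X n) k\<bar>) \<le> e" by blast
    qed
    then show ?thesis by blast
  qed
  have summ: "summable (\<lambda>k. \<bar>l1_nth (X m) k - a k\<bar>)"
    if "\<forall>K. (\<Sum>k<K. \<bar>l1_nth (X m) k - a k\<bar>) \<le> e" for m e
    by (rule bounded_imp_summable[of _ e]) (use that in \<open>auto simp flip: lessThan_Suc_atMost simp del: sum.lessThan_Suc\<close>)
  obtain M where "\<forall>K. (\<Sum>k<K. \<bar>l1_nth (X M) k - a k\<bar>) \<le> 1"
    using tail[of 1] by auto
  then have s: "summable (\<lambda>k. \<bar>l1_nth (X M) k\<bar> + \<bar>l1_nth (X M) k - a k\<bar>)"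
    by (intro summable_add summable_l1_nth summ)
  have "summable (\<lambda>k. \<bar>a k\<bar>)"
    by (rule summable_comparison_test'[OF s]) simp
  then have A: "l1_nth (Abs_l1 a) = a" by (simp add: Abs_l1_inverse)
  have "X \<longlonglongrightarrow> Abs_l1 a"
  proof (rule metric_LIMSEQ_I)
    fix e :: real assume e: "e > 0"
    then obtain M where M: "\<And>m K. m \<ge> M \<Longrightarrow> (\<Sum>k<K. \<bar>l1_nth (X m) k - a k\<bar>) \<le> e / 2"
      using tail[of "e / 2"] by auto
    have "dist (X m) (Abs_l1 a) < e" if "m \<ge> M" for m
    proof -
      have "norm (X m - Abs_l1 a) \<le> e / 2"
        unfolding norm_l1.rep_eq minus_l1.rep_eq A
        using M[OF that] by (intro suminf_le_const summ[of m "e / 2"]) blast+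
      with e show ?thesis by (simp add: dist_norm)
    qed
    then show "\<exists>M. \<forall>m\<ge>M. dist (X m) (Abs_l1 a) < e" by blast
  qed
  then show "convergent X" by (rule convergentI)
qed

text \<open>An isomorphic copy is the image of a linear map that is a homeomorphism onto it,
  for the norm topologies.\<close>

definition contains_isomorphic_copy_l1 :: "'a::real_normed_vector itself \<Rightarrow> bool" where
  "contains_isomorphic_copy_l1 _ \<longleftrightarrow>
     (\<exists>(T :: l1 \<Rightarrow> 'a) S. linear T \<and> homeomorphism UNIV (range T) T S)"

end

theory Submission imports Defs begin

text \<open>Suppose first that \<open>T\<close> embeds \<open>l1\<close> in \<open>E\<close>, and let \<open>e n\<close> be the image of the \<open>n\<close>-th unit vector. Among the
differences \<open>e n - e m\<close> with \<open>n < m\<close> (scaled into the ball) the origin is a weak accumulation point, since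
finitely many functionals are simultaneously almost constant on some infinite set of the \<open>e n\<close>. Identify a difference with the
edge \<open>(n, m)\<close> of a graph on the natural numbers. From countably many infinite edge sets one can select
one edge each so that every new edge brings a new vertex. The selected edges then form a forest, so the vertices carry
signs that differ along each of them. As \<open>T\<close> is an embedding, the Hahn-Banach
theorem yields a functional with exactly these signs as values (up to scaling) on the \<open>e n\<close>; it is bounded away from
\<open>0\<close> on one member of each of the given sets, so no such sequence of sets is a Pytkeev sequence at \<open>0\<close>
(\<open>not_Pytkeev_if_l1\<close>).

Conversely suppose that \<open>E\<close> contains no copy of \<open>l1\<close>. It suffices that a point \<open>x\<close> of the weak closure of a
bounded set \<open>A\<close>, with \<open>x\<close> outside \<open>A\<close>, is the weak limit of a sequence in \<open>A\<close>
(\<open>weakly_convergent_sequence_in_closure\<close>): the tails of the sequence are then the sets required. By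
countable tightness of the weak topology \<open>A\<close> may be taken to be a sequence \<open>g\<close>, and there is an ultrafilter
\<open>p\<close> on the indices along which \<open>h n = g n - x\<close> tends weakly to \<open>0\<close>. What remains is a dichotomy
in the spirit of Rosenthal's \<open>l1\<close> theorem and of the Bourgain-Fremlin-Talagrand theorem.
Fix \<open>e > 0\<close> and consider a game: in each round one player plays a
set in \<open>p\<close>, the other an element \<open>n\<close> of it; the second player survives as long as a single functional
\<open>t\<close> of norm at most \<open>1\<close> has \<open>t (h n) \<ge> e\<close> in the even rounds and \<open>t (h n) \<le> e / 2\<close> in the odd ones.
The game is decided at a finite stage for the first player or never, hence it is determined.

  \<^item> If the second player can survive for some \<open>e\<close>, the surviving moves at each position form a set in \<open>p\<close>, and since
    finite intersections of such sets are in \<open>p\<close>, there is a sequence all of whose finite subsequences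
    survive. Dropping terms turns alternation into independence, and independence gives the \<open>l1\<close> estimate
    (\<open>independent_if_not_forced_exit\<close>, \<open>l1_copy_if_independent\<close>).
  \<^item> If the first player wins for every \<open>e\<close>, the countably many positions allow one to amalgamate the strategies
    into a relation on the naturals such that no functional alternates forever along any of its chains. If a functional
    did not tend to \<open>0\<close> along one chain, one could interleave that chain with elements of a set in \<open>p\<close> on which
    the functional is small, and obtain a chain along which it alternates. Thus every chain is weakly
    null (\<open>null_subsequence_if_forced_exit\<close>).\<close>

section \<open>Ultrafilters\<close>

definition ultrafilter :: "'i filter \<Rightarrow> bool" where
  "ultrafilter p \<longleftrightarrow> p \<noteq> bot \<and> (\<forall>P. eventually P p \<or> eventually (\<lambda>i. \<not> P i) p)"

lemma ultrafilter_imp_not_bot: "ultrafilter p \<Longrightarrow> p \<noteq> bot"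
  by (simp add: ultrafilter_def)

lemma ultrafilter_eventually_not:
  assumes "ultrafilter p"
  shows "eventually (\<lambda>i. \<not> P i) p \<longleftrightarrow> \<not> eventually P p"
proof -
  have "\<not> (eventually P p \<and> eventually (\<lambda>i. \<not> P i) p)"
    using eventually_conj[of P p "\<lambda>i. \<not> P i"] assms
    by (auto simp: ultrafilter_def)
  then show ?thesis using assms unfolding ultrafilter_def by blast
qed

lemma ex_ultrafilter_le:
  fixes F :: "'i filter"
  assumes "F \<noteq> bot"
  shows "\<exists>p\<le>F. ultrafilter p"
proof -
  define A where "A = {G. G \<le> F \<and> G \<noteq> bot}"
  have "\<exists>p\<in>A. \<forall>q\<in>A. q \<le> p \<longrightarrow> q = p"
  proof (rule predicate_Zorn)
    show "partial_order_on A (relation_of (\<lambda>p q. q \<le> p) A)"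
      by (rule partial_order_on_relation_ofI) auto
  next
    fix C assume "C \<in> Chains (relation_of (\<lambda>p q. q \<le> p) A)"
    then have C: "C \<subseteq> A" "\<And>p q. p \<in> C \<Longrightarrow> q \<in> C \<Longrightarrow> p \<le> q \<or> q \<le> p"
      by (auto simp: Chains_def relation_of_def)
    show "\<exists>u\<in>A. \<forall>q\<in>C. u \<le> q"
    proof (cases "C = {}")
      case True
      then show ?thesis using assms by (auto simp: A_def)
    next
      case False
      have "X \<noteq> {} \<longrightarrow> Inf X \<in> C" if "finite X" "X \<subseteq> C" for X
        using that
      proof (induction rule: finite_induct)
        case (insert q X)
        show ?case
        proof (cases "X = {}")
          case False
          then have "Inf X \<in> C" "q \<in> C" using insert by auto
          then have "inf q (Inf X) \<in> C"
            using C(2)[of q "Inf X"] by (auto simp: inf_absorb1 inf_absorb2)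
          then show ?thesis by simp
        qed (use insert in auto)
      qed simp
      then have "Inf X \<in> C" if "finite X" "X \<subseteq> C" "X \<noteq> {}" for X
        using that by blast
      moreover have "Inf ({} :: 'i filter set) \<noteq> bot" using assms by (metis Inf_empty top_greatest bot_unique)
      ultimately have "Inf X \<noteq> bot" if "finite X" "X \<subseteq> C" for X
        using that C(1) by (cases "X = {}") (auto simp: A_def)
      then have "Inf C \<noteq> bot" by (rule Inf_filter_not_bot) auto
      moreover have "Inf C \<le> F" using False C(1) by (auto simp: A_def intro: Inf_lower2)
      ultimately show ?thesis by (intro bexI[of _ "Inf C"]) (auto simp: A_def Inf_lower)
    qed
  qed
  then obtain p where p: "p \<le> F" "p \<noteq> bot"
    and max: "\<And>q. q \<le> F \<Longrightarrow> q \<noteq> bot \<Longrightarrow> q \<le> p \<Longrightarrow> q = p"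
    by (auto simp: A_def)
  have "eventually P p \<or> eventually (\<lambda>i. \<not> P i) p" for P
  proof (cases "eventually P p")
    case False
    define q where "q = inf p (principal {i. \<not> P i})"
    have "q \<noteq> bot"
      using False
      by (simp add: q_def trivial_limit_def eventually_inf_principal)
    moreover have "q \<le> p" by (simp add: q_def)
    ultimately have "q = p" using max[of q] p(1) by auto
    then have "p \<le> principal {i. \<not> P i}" unfolding q_def by (metis inf.cobounded2)
    then show ?thesis by (simp add: le_principal)
  qed simp
  then show ?thesis using p by (auto simp: ultrafilter_def)
qed

text \<open>Compactness of an interval gives a cluster point, and an ultrafilter converges to each of its cluster points.\<close>

lemma ultrafilter_bounded_limit:
  fixes f :: "'i \<Rightarrow> real"
  assumes p: "ultrafilter p" and b: "\<And>i. \<bar>f i\<bar> \<le> C"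
  shows "\<exists>L. (f \<longlongrightarrow> L) p"
proof -
  have bot: "filtermap f p \<noteq> bot"
    using p by (simp add: ultrafilter_def filtermap_bot_iff)
  have "eventually (\<lambda>x. x \<in> {-C..C}) (filtermap f p)"
    unfolding eventually_filtermap
    by (rule always_eventually) (use b in \<open>auto simp: abs_le_iff minus_le_iff\<close>)
  then obtain L where L: "inf (nhds L) (filtermap f p) \<noteq> bot"
    using compact_Icc[of "-C" C] bot unfolding compact_filter by blast
  have "(f \<longlongrightarrow> L) p"
  proof (rule topological_tendstoI)
    fix S assume S: "open S" "L \<in> S"
    show "eventually (\<lambda>i. f i \<in> S) p"
    proof (rule ccontr)
      assume "\<not> eventually (\<lambda>i. f i \<in> S) p"
      then have "eventually (\<lambda>x. x \<notin> S) (filtermap f p)"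
        using ultrafilter_eventually_not[OF p, of "\<lambda>i. f i \<in> S"] by (simp add: eventually_filtermap)
      moreover have "eventually (\<lambda>x. x \<in> S) (nhds L)" using S eventually_nhds by blast
      ultimately have "eventually (\<lambda>x. False) (inf (nhds L) (filtermap f p))"
        unfolding eventually_inf by blast
      then show False using L by (simp add: trivial_limit_def)
    qed
  qed
  then show ?thesis ..
qed

lemma ultrafilter_eventually_bex_finite:
  assumes p: "ultrafilter p" and "finite I" and "eventually (\<lambda>x. \<exists>i\<in>I. P i x) p"
  shows "\<exists>i\<in>I. eventually (P i) p"
proof (rule ccontr)
  assume "\<not> ?thesis"
  then have "\<forall>i\<in>I. eventually (\<lambda>x. \<not> P i x) p"
    using ultrafilter_eventually_not[OF p] by blast
  then have "eventually (\<lambda>x. \<forall>i\<in>I. \<not> P i x) p" using \<open>finite I\<close> by (simp add: eventually_ball_finite)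
  then have "eventually (\<lambda>x. \<not> (\<exists>i\<in>I. P i x)) p" by (rule eventually_mono) auto
  then show False using assms(3) ultrafilter_eventually_not[OF p] by blast
qed

section \<open>The Hahn-Banach theorem and the weak topology\<close>

text \<open>Linear functionals are handled through their graphs: a subspace \<open>G\<close> of \<open>'a \<times> real\<close> on which
  \<open>r \<le> c * norm x\<close> contains no vertical line, so maximality by inclusion is maximality of
  the functional. The usual one-dimensional extension step shows that a maximal graph has full domain.\<close>

lemma Hahn_Banach_graph:
  fixes G0 :: "('a::real_normed_vector \<times> real) set"
  assumes G0: "subspace G0" and c: "0 \<le> c"
    and dom: "\<And>x r. (x, r) \<in> G0 \<Longrightarrow> r \<le> c * norm x"
  shows "\<exists>f :: 'a \<Rightarrow>\<^sub>L real. norm f \<le> c \<and> (\<forall>(x, r)\<in>G0. blinfun_apply f x = r)"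
proof -
  define A where "A = {G. subspace G \<and> G0 \<subseteq> G \<and> (\<forall>(x, r)\<in>G. r \<le> c * norm x)}"
  have "\<exists>M\<in>A. \<forall>X\<in>A. M \<subseteq> X \<longrightarrow> X = M"
  proof (rule subset_Zorn_nonempty)
    show "A \<noteq> {}" using G0 dom by (auto simp: A_def)
  next
    fix \<C> assume "\<C> \<noteq> {}" and ch: "subset.chain A \<C>"
    then have CA: "\<C> \<subseteq> A" and lin: "\<And>X Y. X \<in> \<C> \<Longrightarrow> Y \<in> \<C> \<Longrightarrow> X \<subseteq> Y \<or> Y \<subseteq> X"
      by (auto simp: subset_chain_def)
    have "subspace (\<Union>\<C>)"
    proof (rule subspaceI)
      show "0 \<in> \<Union>\<C>" using \<open>\<C> \<noteq> {}\<close> CA by (auto simp: A_def subspace_def)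
    next
      fix u v assume "u \<in> \<Union>\<C>" "v \<in> \<Union>\<C>"
      then obtain X where "X \<in> \<C>" "u \<in> X" "v \<in> X" using lin by blast
      moreover from this have "u + v \<in> X" using CA by (auto simp: A_def intro: subspace_add)
      ultimately show "u + v \<in> \<Union>\<C>" by blast
    next
      fix a :: real and u assume "u \<in> \<Union>\<C>"
      then obtain X where "X \<in> \<C>" "u \<in> X" by blast
      moreover from this have "a *\<^sub>R u \<in> X" using CA by (auto simp: A_def intro: subspace_scale)
      ultimately show "a *\<^sub>R u \<in> \<Union>\<C>" by blast
    qed
    moreover have "G0 \<subseteq> \<Union>\<C>" using \<open>\<C> \<noteq> {}\<close> CA by (auto simp: A_def)
    moreover have "r \<le> c * norm x" if "(x, r) \<in> \<Union>\<C>" for x r using that CA by (auto simp: A_def)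
    ultimately show "\<Union>\<C> \<in> A" by (auto simp: A_def)
  qed
  then obtain M where "M \<in> A" and max: "\<And>X. X \<in> A \<Longrightarrow> M \<subseteq> X \<Longrightarrow> X = M" by blast
  then have M: "subspace M" "G0 \<subseteq> M" and M_le: "\<And>x r. (x, r) \<in> M \<Longrightarrow> r \<le> c * norm x"
    by (auto simp: A_def)
  have full: "\<exists>r. (x0, r) \<in> M" for x0
  proof -
    \<comment> \<open>A value \<open>s\<close> for the extension at \<open>x0\<close> must lie above all left sides and below all right sides.\<close>
    have sep: "r - c * norm (x - x0) \<le> c * norm (y + x0) - q" if "(x, r) \<in> M" "(y, q) \<in> M" for x r y q
    proof -
      have "r + q \<le> c * norm (x + y)"
        using M_le[of "x + y" "r + q"] subspace_add[OF M(1) that] by simp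
      also have "\<dots> \<le> c * (norm (x - x0) + norm (y + x0))"
        using norm_triangle_ineq[of "x - x0" "y + x0"] c by (intro mult_left_mono) (auto simp: algebra_simps)
      finally show ?thesis by (simp add: algebra_simps)
    qed
    define s where "s = (SUP (x, r)\<in>M. r - c * norm (x - x0))"
    have M0: "(0, 0) \<in> M" using subspace_0[OF M(1)] by (simp add: zero_prod_def)
    have bdd: "bdd_above ((\<lambda>(x, r). r - c * norm (x - x0)) ` M)"
      by (rule bdd_aboveI[of _ "c * norm (0 + x0) - 0"]) (use sep[OF _ M0] in auto)
    have lo: "r - c * norm (x - x0) \<le> s" if "(x, r) \<in> M" for x r
      unfolding s_def using cSUP_upper[OF that bdd] by simp
    have hi: "s \<le> c * norm (y + x0) - q" if "(y, q) \<in> M" for y q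
      unfolding s_def using M0 sep[OF _ that] by (intro cSUP_least) auto
    define G where "G = {(x + a *\<^sub>R x0, r + a * s) | x r a. (x, r) \<in> M}"
    have "subspace G"
    proof (rule subspaceI)
      show "0 \<in> G" unfolding G_def using M0 by (force simp: zero_prod_def)
    next
      fix u v assume "u \<in> G" "v \<in> G"
      then obtain x r a y q b where "(x, r) \<in> M" "(y, q) \<in> M"
        "u = (x + a *\<^sub>R x0, r + a * s)" "v = (y + b *\<^sub>R x0, q + b * s)"
        unfolding G_def by blast
      moreover from this have "(x + y, r + q) \<in> M"
        using subspace_add[OF M(1), of "(x, r)" "(y, q)"] by simp
      ultimately show "u + v \<in> G" unfolding G_def
        by (intro CollectI exI[of _ "x + y"] exI[of _ "r + q"] exI[of _ "a + b"]) (simp add: algebra_simps)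
    next
      fix k :: real and u assume "u \<in> G"
      then obtain x r a where "(x, r) \<in> M" "u = (x + a *\<^sub>R x0, r + a * s)"
        unfolding G_def by blast
      moreover from this have "(k *\<^sub>R x, k * r) \<in> M" using subspace_scale[OF M(1), of "(x, r)" k] by simp
      ultimately show "k *\<^sub>R u \<in> G" unfolding G_def
        by (intro CollectI exI[of _ "k *\<^sub>R x"] exI[of _ "k * r"] exI[of _ "k * a"]) (simp add: algebra_simps)
    qed
    moreover have MG: "M \<subseteq> G" unfolding G_def by force
    moreover have "r + a * s \<le> c * norm (x + a *\<^sub>R x0)" if "(x, r) \<in> M" for x r a
    proof -
      have sc: "(k *\<^sub>R x, k * r) \<in> M" for k using subspace_scale[OF M(1) that, of k] by simp
      consider "a = 0" | "a > 0" | "a < 0" by linarith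
      then show ?thesis
      proof cases
        case 1
        then show ?thesis using M_le[OF that] by simp
      next
        case 2
        define y where "y = inverse a *\<^sub>R x + x0"
        have "x + a *\<^sub>R x0 = a *\<^sub>R y" using 2 by (simp add: y_def scaleR_add_right)
        then have y: "norm (x + a *\<^sub>R x0) = a * norm y" using 2 by simp
        have "a * s \<le> a * (c * norm y - inverse a * r)"
          using hi[OF sc] 2 unfolding y_def by (intro mult_left_mono) auto
        also have "\<dots> = c * (a * norm y) - r"
          using 2 by (simp add: field_simps)
        finally show ?thesis unfolding y by simp
      next
        case 3
        define b where "b = - a"
        have b: "b > 0" "a = - b" using 3 by (auto simp: b_def)
        define y where "y = inverse b *\<^sub>R x - x0"
        have "x + a *\<^sub>R x0 = b *\<^sub>R y" using b by (simp add: y_def scaleR_diff_right)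
        then have y: "norm (x + a *\<^sub>R x0) = b * norm y" using b by simp
        have "b * (inverse b * r - c * norm y) \<le> b * s"
          using lo[OF sc] b unfolding y_def by (intro mult_left_mono) auto
        moreover have "b * (inverse b * r - c * norm y) = r - c * (b * norm y)"
          using b by (simp add: field_simps)
        ultimately show ?thesis unfolding y using b by simp
      qed
    qed
    ultimately have "G \<in> A" unfolding A_def using M(2) by (auto simp: G_def)
    then have "G = M" using max MG by blast
    moreover have "(0 + 1 *\<^sub>R x0, 0 + 1 * s) \<in> G" unfolding G_def using M0 by blast
    ultimately show ?thesis by auto
  qed
  have uniq: "r = q" if "(x, r) \<in> M" "(x, q) \<in> M" for x r q
    using M_le[of 0 "r - q"] M_le[of 0 "q - r"] subspace_diff[OF M(1) that(1) that(2)]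
      subspace_diff[OF M(1) that(2) that(1)] by simp
  define f where "f x = (THE r. (x, r) \<in> M)" for x
  have fM: "(x, f x) \<in> M" for x
  proof -
    obtain r where "(x, r) \<in> M" using full by blast
    moreover from this have "f x = r" unfolding f_def using uniq by (intro the_equality) auto
    ultimately show ?thesis by simp
  qed
  have lin: "linear f"
  proof (rule linearI)
    fix x y show "f (x + y) = f x + f y"
      using uniq[OF fM[of "x + y"]] subspace_add[OF M(1) fM fM, of x y] by simp
  next
    fix a x show "f (a *\<^sub>R x) = a *\<^sub>R f x"
      using uniq[OF fM[of "a *\<^sub>R x"]] subspace_scale[OF M(1) fM, of a x] by simp
  qed
  have le: "norm (f x) \<le> c * norm x" for x
    using M_le[OF fM[of x]] M_le[OF fM[of "-x"]] linear_neg[OF lin, of x] by auto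
  have bl: "bounded_linear f"
    using lin le by (intro bounded_linear_intro[of f c]) (auto simp: linear_add linear_scale mult.commute)
  then have app: "blinfun_apply (Blinfun f) = f" by (rule bounded_linear_Blinfun_apply)
  have "norm (Blinfun f) \<le> c" using le c by (intro norm_blinfun_bound) (auto simp: app)
  moreover have "\<forall>(x, r)\<in>G0. blinfun_apply (Blinfun f) x = r" using uniq[OF fM] M(2) by (auto simp: app)
  ultimately show ?thesis by blast
qed

lemma functional_nonzero_at:
  fixes v :: "'a::real_normed_vector"
  assumes "v \<noteq> 0"
  shows "\<exists>f :: 'a \<Rightarrow>\<^sub>L real. blinfun_apply f v \<noteq> 0"
proof -
  define G where "G = {(a *\<^sub>R v, a * norm v) | a. True}"
  have "subspace G"
    unfolding G_def subspace_def
    by (auto simp: zero_prod_def scaleR_add_left[symmetric] distrib_right[symmetric])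
  moreover have "r \<le> 1 * norm x" if "(x, r) \<in> G" for x r
    using that by (auto simp: G_def mult_right_mono)
  ultimately obtain f :: "'a \<Rightarrow>\<^sub>L real" where "\<forall>(x, r)\<in>G. blinfun_apply f x = r"
    using Hahn_Banach_graph[of G 1] by auto
  moreover have "(v, norm v) \<in> G" unfolding G_def by (auto intro: exI[of _ 1])
  ultimately show ?thesis using assms by (intro exI[of _ f]) auto
qed

text \<open>Convergence against every functional is weak convergence, along an arbitrary filter: the open sets satisfying the
conclusion are closed under the operations that generate the topology.\<close>

lemma eventually_weak_nbhd:
  fixes x :: "'a::real_normed_vector"
  assumes lim: "\<And>t :: 'a \<Rightarrow>\<^sub>L real. ((\<lambda>i. blinfun_apply t (y i)) \<longlongrightarrow> blinfun_apply t x) F"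
    and U: "openin weak_topology U" "x \<in> U"
  shows "eventually (\<lambda>i. y i \<in> U) F"
proof -
  have "generate_topology_on {blinfun_apply f -` U | (f :: 'a \<Rightarrow>\<^sub>L real) U. open U} U"
    using U(1) unfolding weak_topology_def openin_topology_generated_by_iff .
  then show ?thesis using U(2)
  proof induction
    case (Int a b)
    then show ?case by (simp add: eventually_conj)
  next
    case (UN K)
    then obtain k where k: "k \<in> K" "x \<in> k" by blast
    then have "eventually (\<lambda>i. y i \<in> k) F" using UN by blast
    then show ?case by (rule eventually_mono) (use k in blast)
  next
    case (Basis s)
    then obtain f :: "'a \<Rightarrow>\<^sub>L real" and V where "s = blinfun_apply f -` V" "open V" by auto
    with Basis show ?case using topological_tendstoD[OF lim[of f], of V] by simp
  qed simp
qed

lemma openin_weak_preimage: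
  fixes f :: "'a::real_normed_vector \<Rightarrow>\<^sub>L real"
  shows "open V \<Longrightarrow> openin weak_topology (blinfun_apply f -` V)"
  unfolding weak_topology_def by (rule topology_generated_by_Basis) blast

section \<open>A copy of l1 destroys the Pytkeev property\<close>

definition l1_unit :: "nat \<Rightarrow> l1" where
  "l1_unit n = Abs_l1 (\<lambda>k. if k = n then 1 else 0)"

lemma l1_nth_unit: "l1_nth (l1_unit n) = (\<lambda>k. if k = n then 1 else 0)"
proof -
  have "summable (\<lambda>k. \<bar>if k = n then 1 else 0 :: real\<bar>)"
    by (rule summable_finite[of "{n}"]) auto
  then show ?thesis unfolding l1_unit_def by (subst Abs_l1_inverse) auto
qed

lemma norm_l1_unit: "norm (l1_unit n) = 1"
  unfolding norm_l1.rep_eq l1_nth_unit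
  by (subst suminf_finite[of "{n}"]) auto

text \<open>Stated on a subspace so that it applies both to an embedding and to its inverse, which is defined on the range only.\<close>

lemma continuous_homogeneous_bounded:
  fixes f :: "'a::real_normed_vector \<Rightarrow> 'b::real_normed_vector"
  assumes "subspace D" and cont: "continuous_on D f"
    and hom: "\<And>a x. x \<in> D \<Longrightarrow> f (a *\<^sub>R x) = a *\<^sub>R f x"
  shows "\<exists>B>0. \<forall>x\<in>D. norm (f x) \<le> B * norm x"
proof -
  have D0: "0 \<in> D" using assms(1) by (rule subspace_0)
  have f0: "f 0 = 0" using hom[OF D0, of 0] by simp
  obtain d where d: "d > 0" "\<And>y. y \<in> D \<Longrightarrow> dist y 0 < d \<Longrightarrow> dist (f y) (f 0) < 1"
    using cont[unfolded continuous_on_iff, rule_format, OF D0, of 1] by auto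
  have "norm (f x) \<le> (2 / d) * norm x" if x: "x \<in> D" for x
  proof (cases "x = 0")
    case False
    define k where "k = d / (2 * norm x)"
    have k: "k > 0" "k * norm x = d / 2" using False d(1) by (auto simp: k_def)
    have "k *\<^sub>R x \<in> D" using assms(1) x by (rule subspace_scale)
    moreover have "norm (k *\<^sub>R x) < d" using k d(1) by simp
    ultimately have "norm (f (k *\<^sub>R x)) < 1" using d(2)[of "k *\<^sub>R x"] f0 by simp
    then have "k * norm (f x) < 1" using k hom[OF x] by simp
    then have "norm (f x) < 1 / k" using k by (simp add: field_simps)
    also have "1 / k = (2 / d) * norm x" by (simp add: k_def)
    finally show ?thesis by simp
  qed (simp add: f0)
  then show ?thesis using d(1) by (intro exI[of _ "2 / d"]) simp
qed

text \<open>On \<open>l1\<close> the functional is the pairing with the bounded sequence \<open>\<sigma>\<close>; it is carried over to the range of \<open>T\<close> by the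
continuous inverse and extended from there by the Hahn-Banach theorem.\<close>

lemma functional_with_values_on_l1_copy:
  fixes T :: "l1 \<Rightarrow> 'a::real_normed_vector" and \<sigma> :: "nat \<Rightarrow> real"
  assumes T: "linear T" and hom: "homeomorphism UNIV (range T) T S" and \<sigma>: "\<And>k. \<bar>\<sigma> k\<bar> \<le> 1"
  shows "\<exists>f :: 'a \<Rightarrow>\<^sub>L real. \<forall>n. blinfun_apply f (T (l1_unit n)) = \<sigma> n"
proof -
  have ST: "S (T c) = c" for c using hom by (simp add: homeomorphism_def)
  have "\<exists>B>0. \<forall>x\<in>range T. norm (S x) \<le> B * norm x"
  proof (rule continuous_homogeneous_bounded)
    show "subspace (range T)" using linear_subspace_image[OF T subspace_UNIV] .
    show "continuous_on (range T) S" using hom by (simp add: homeomorphism_def)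
    show "S (a *\<^sub>R x) = a *\<^sub>R S x" if "x \<in> range T" for a x
      using that by (auto simp: ST simp flip: linear_scale[OF T])
  qed
  then obtain B where B: "B > 0" "\<And>c. norm c \<le> B * norm (T c)" by (auto simp: ST)
  define \<phi> where "\<phi> c = (\<Sum>k. \<sigma> k * l1_nth c k)" for c
  have le: "\<bar>\<sigma> k * l1_nth c k\<bar> \<le> \<bar>l1_nth c k\<bar>" for c k
    using mult_right_mono[OF \<sigma>, of "\<bar>l1_nth c k\<bar>" k] by (simp add: abs_mult)
  have sa: "summable (\<lambda>k. \<bar>\<sigma> k * l1_nth c k\<bar>)" for c
    by (rule summable_comparison_test'[OF summable_l1_nth[of c], of 0]) (simp add: le)
  then have s: "summable (\<lambda>k. \<sigma> k * l1_nth c k)" for c by (rule summable_rabs_cancel)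
  have \<phi>_add: "\<phi> (c + d) = \<phi> c + \<phi> d" for c d
    unfolding \<phi>_def by (simp add: suminf_add[OF s s] plus_l1.rep_eq distrib_left)
  have \<phi>_scale: "\<phi> (a *\<^sub>R c) = a * \<phi> c" for a c
    unfolding \<phi>_def by (simp add: suminf_mult[OF s, symmetric] scaleR_l1.rep_eq mult.left_commute)
  have \<phi>_le: "\<phi> c \<le> norm c" for c
  proof -
    have "\<phi> c \<le> (\<Sum>k. \<bar>\<sigma> k * l1_nth c k\<bar>)"
      unfolding \<phi>_def by (rule suminf_le[OF _ s sa]) simp
    also have "\<dots> \<le> norm c"
      unfolding norm_l1.rep_eq by (rule suminf_le[OF le sa summable_l1_nth])
    finally show ?thesis .
  qed
  have \<phi>_unit: "\<phi> (l1_unit n) = \<sigma> n" for n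
    unfolding \<phi>_def l1_nth_unit by (subst suminf_finite[of "{n}"]) auto
  define G where "G = range (\<lambda>c. (T c, \<phi> c))"
  have "linear (\<lambda>c. (T c, \<phi> c))"
    using T \<phi>_add \<phi>_scale by (intro linearI) (auto simp: linear_add linear_scale)
  then have "subspace G" unfolding G_def using linear_subspace_image subspace_UNIV by blast
  moreover have "r \<le> B * norm x" if "(x, r) \<in> G" for x r
    using that B(2) \<phi>_le order_trans by (fastforce simp: G_def)
  ultimately obtain f :: "'a \<Rightarrow>\<^sub>L real" where "\<forall>(x, r)\<in>G. blinfun_apply f x = r"
    using Hahn_Banach_graph[of G B] B(1) by auto
  then have "blinfun_apply f (T (l1_unit n)) = \<sigma> n" for n by (auto simp: G_def \<phi>_unit)
  then show ?thesis by blast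
qed

text \<open>The two-colouring of a forest given by parent pointers \<open>q\<close>, by the signs \<open>1\<close> and \<open>-1\<close>. Vertices whose pointer does not decrease are
roots.\<close>

fun alternating_sign :: "(nat \<Rightarrow> nat) \<Rightarrow> nat \<Rightarrow> real" where
  "alternating_sign q k = (if q k < k then - alternating_sign q (q k) else 1)"

declare alternating_sign.simps [simp del]

lemma abs_alternating_sign: "\<bar>alternating_sign q k\<bar> = 1"
  by (induction q k rule: alternating_sign.induct) (subst alternating_sign.simps, simp)

text \<open>The set \<open>A\<close> of scaled differences \<open>a n m\<close> accumulates weakly at \<open>0\<close>, but any infinite subsets of \<open>A\<close> contain edges
\<open>(N i, M i)\<close> with strictly increasing larger endpoints \<open>M i\<close>. Making \<open>N i\<close> the parent of \<open>M i\<close>, the signs alternate along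
all these edges simultaneously.\<close>

lemma not_Pytkeev_if_l1:
  assumes "contains_isomorphic_copy_l1 TYPE('a::real_normed_vector)"
  shows "\<not> Pytkeev_space (subtopology (weak_topology :: 'a topology) (cball 0 1))"
proof
  let ?X = "subtopology (weak_topology :: 'a topology) (cball 0 1)"
  assume pyt: "Pytkeev_space ?X"
  obtain T :: "l1 \<Rightarrow> 'a" and S where T: "linear T" and hom: "homeomorphism UNIV (range T) T S"
    using assms by (auto simp: contains_isomorphic_copy_l1_def)
  have inj: "T x = T y \<Longrightarrow> x = y" for x y using hom by (auto simp: homeomorphism_def) metis
  obtain B where B: "B > 0" "\<And>c. norm (T c) \<le> B * norm c"
    using continuous_homogeneous_bounded[OF subspace_UNIV, of T] hom linear_scale[OF T]
    by (auto simp: homeomorphism_def)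
  define e where "e n = T (l1_unit n)" for n
  have norm_e: "norm (e n) \<le> B" for n using B(2)[of "l1_unit n"] by (simp add: e_def norm_l1_unit)
  define a where "a n m = (1 / (2 * B)) *\<^sub>R (e n - e m)" for n m
  have a_ball: "a n m \<in> cball 0 1" for n m
  proof -
    have "norm (e n - e m) \<le> 2 * B" using norm_triangle_ineq4[of "e n" "e m"] norm_e[of n] norm_e[of m] by simp
    then show ?thesis using B(1) by (simp add: a_def divide_le_eq)
  qed
  define A where "A = {a n m | n m. n < m}"
  have "0 \<notin> A"
  proof
    assume "0 \<in> A"
    then obtain n m where "n < m" "e n = e m" using B(1) by (auto simp: A_def a_def)
    then have "l1_nth (l1_unit n) n = l1_nth (l1_unit m) n" using inj unfolding e_def by metis
    then show False using \<open>n < m\<close> by (simp add: l1_nth_unit)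
  qed
  moreover have "0 \<in> ?X closure_of A"
  proof -
    have "\<exists>y\<in>A. y \<in> V" if V: "openin ?X V" "0 \<in> V" for V
    proof -
      obtain U where U: "openin weak_topology U" "V = U \<inter> cball 0 1"
        using V(1) by (auto simp: openin_subtopology)
      obtain p where p: "p \<le> sequentially" "ultrafilter p"
        using ex_ultrafilter_le[of sequentially] by auto
      \<comment> \<open>Both \<open>t (e n)\<close> and \<open>t (e m)\<close> have the same limit along \<open>p\<close>, so the difference tends to \<open>0\<close> along the product filter.\<close>
      have "((\<lambda>z. blinfun_apply t (case z of (n, m) \<Rightarrow> a n m)) \<longlongrightarrow> blinfun_apply t 0) (p \<times>\<^sub>F p)"
        for t :: "'a \<Rightarrow>\<^sub>L real"
      proof -
        have "\<bar>blinfun_apply t (e n)\<bar> \<le> norm t * B" for n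
          using norm_blinfun[of t "e n"] mult_left_mono[OF norm_e[of n], of "norm t"] by simp
        then obtain L where L: "((\<lambda>n. blinfun_apply t (e n)) \<longlongrightarrow> L) p"
          using ultrafilter_bounded_limit[OF p(2), of "\<lambda>n. blinfun_apply t (e n)"] by blast
        have "((\<lambda>z. (1 / (2 * B)) * (blinfun_apply t (e (fst z)) - blinfun_apply t (e (snd z))))
            \<longlongrightarrow> (1 / (2 * B)) * (L - L)) (p \<times>\<^sub>F p)"
          by (intro tendsto_intros filterlim_compose[OF L] filterlim_fst filterlim_snd)
        then show ?thesis by (simp add: a_def case_prod_beta blinfun.bilinear_simps)
      qed
      then have "eventually (\<lambda>z. (case z of (n, m) \<Rightarrow> a n m) \<in> U) (p \<times>\<^sub>F p)"
        by (rule eventually_weak_nbhd) (use U V in auto)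
      then obtain Q where Q: "eventually Q p" "\<And>n m. Q n \<Longrightarrow> Q m \<Longrightarrow> a n m \<in> U"
        unfolding eventually_prod_same by auto
      note bot = ultrafilter_imp_not_bot[OF p(2)]
      obtain n where n: "Q n" using eventually_happens'[OF bot Q(1)] by blast
      have "eventually (\<lambda>m. n < m) p" using filter_leD[OF p(1) eventually_gt_at_top] .
      from eventually_happens'[OF bot eventually_conj[OF this Q(1)]]
      obtain m where "n < m" "Q m" by blast
      have "a n m \<in> A" unfolding A_def using \<open>n < m\<close> by blast
      moreover have "a n m \<in> V" using Q(2)[OF n \<open>Q m\<close>] a_ball U(2) by blast
      ultimately show ?thesis ..
    qed
    then show ?thesis by (auto simp: in_closure_of)
  qed
  moreover have "A \<subseteq> topspace ?X" using a_ball by (auto simp: A_def)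
  ultimately have "\<exists>B :: nat \<Rightarrow> 'a set. (\<forall>n. infinite (B n) \<and> B n \<subseteq> A) \<and>
      (\<forall>N. N \<subseteq> topspace ?X \<longrightarrow> (\<exists>U. openin ?X U \<and> 0 \<in> U \<and> U \<subseteq> N) \<longrightarrow> (\<exists>n. B n \<subseteq> N))"
    by (intro pyt[unfolded Pytkeev_space_def, rule_format]) auto
  then obtain Bs :: "nat \<Rightarrow> 'a set" where Bs: "\<And>i. infinite (Bs i)" "\<And>i. Bs i \<subseteq> A"
    and catch: "\<And>N. N \<subseteq> topspace ?X \<Longrightarrow> \<exists>U. openin ?X U \<and> 0 \<in> U \<and> U \<subseteq> N \<Longrightarrow> \<exists>i. Bs i \<subseteq> N"
    by blast
  \<comment> \<open>Only finitely many elements of \<open>A\<close> come from edges with both endpoints below a given bound.\<close>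
  have edge: "\<exists>n m. n < m \<and> k < m \<and> a n m \<in> Bs i" for i k
  proof (rule ccontr)
    assume none: "\<not> ?thesis"
    have "Bs i \<subseteq> case_prod a ` ({..k} \<times> {..k})"
    proof
      fix y assume y: "y \<in> Bs i"
      then have "y \<in> A" using Bs(2) by blast
      then obtain n m where "n < m" "y = a n m" unfolding A_def by blast
      moreover from this have "m \<le> k" using none y by (meson not_le)
      ultimately show "y \<in> case_prod a ` ({..k} \<times> {..k})" by force
    qed
    then show False using Bs(1) finite_subset by blast
  qed
  have "\<exists>E. \<forall>i. (fst (E i) < snd (E i) \<and> a (fst (E i)) (snd (E i)) \<in> Bs i) \<and> snd (E i) < snd (E (Suc i))"
  proof (rule dependent_nat_choice)
    show "\<exists>z. fst z < snd z \<and> a (fst z) (snd z) \<in> Bs 0" using edge[of 0 0] by auto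
    show "\<exists>z'. (fst z' < snd z' \<and> a (fst z') (snd z') \<in> Bs (Suc i)) \<and> snd z < snd z'" for z and i :: nat
      using edge[of "snd z" "Suc i"] by force
  qed
  then obtain E where E: "\<And>i. fst (E i) < snd (E i)" "\<And>i. a (fst (E i)) (snd (E i)) \<in> Bs i"
    "\<And>i. snd (E i) < snd (E (Suc i))" by blast
  define M where "M = snd \<circ> E"
  define N where "N = fst \<circ> E"
  have "strict_mono M" using E(3) by (auto simp: M_def strict_mono_Suc_iff)
  then have injM: "inj M" by (rule strict_mono_imp_inj_on)
  define q where "q k = (if k \<in> range M then N (inv M k) else k)" for k
  define \<sigma> where "\<sigma> = alternating_sign q"
  have "q (M i) = N i" for i by (simp add: q_def inv_f_f[OF injM])
  then have \<sigma>_edge: "\<sigma> (M i) = - \<sigma> (N i)" for i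
    unfolding \<sigma>_def using E(1)[of i] by (subst alternating_sign.simps) (simp add: M_def N_def)
  obtain f :: "'a \<Rightarrow>\<^sub>L real" where f: "\<And>n. blinfun_apply f (e n) = \<sigma> n"
    using functional_with_values_on_l1_copy[OF T hom, of \<sigma>] abs_alternating_sign[of q]
    unfolding \<sigma>_def e_def by (metis order_refl)
  let ?V = "{y \<in> cball 0 1. \<bar>blinfun_apply f y\<bar> < 1 / B}"
  have "openin ?X ?V"
    unfolding openin_subtopology
    by (intro exI[of _ "blinfun_apply f -` {-(1 / B)<..<1 / B}"] conjI openin_weak_preimage) (auto simp: abs_less_iff)
  then have "\<exists>i. Bs i \<subseteq> ?V" using B(1) by (intro catch exI[of _ ?V]) auto
  then obtain i where "Bs i \<subseteq> ?V" ..
  then have "\<bar>blinfun_apply f (a (N i) (M i))\<bar> < 1 / B" using E(2)[of i] by (auto simp: M_def N_def)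
  moreover have "\<bar>blinfun_apply f (a (N i) (M i))\<bar> = 1 / B"
    using abs_alternating_sign[of q "N i"] B(1)
    by (simp add: a_def blinfun.bilinear_simps f \<sigma>_edge \<sigma>_def[symmetric] abs_mult)
  ultimately show False by simp
qed

section \<open>Countable tightness of the weak topology\<close>

definition weakly_adherent :: "'a::real_normed_vector \<Rightarrow> 'a set \<Rightarrow> bool" where
  "weakly_adherent x A \<longleftrightarrow> (\<forall>T :: ('a \<Rightarrow>\<^sub>L real) set. finite T \<longrightarrow>
     (\<forall>e>0. \<exists>a\<in>A. \<forall>t\<in>T. \<bar>blinfun_apply t (a - x)\<bar> < e))"

lemma weakly_adherent_if_in_closure:
  assumes "x \<in> subtopology weak_topology C closure_of A" and "A \<subseteq> C"
  shows "weakly_adherent x A"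
  unfolding weakly_adherent_def
proof (intro allI impI)
  fix T :: "('a \<Rightarrow>\<^sub>L real) set" and e :: real assume T: "finite T" "e > 0"
  define U where "U = (\<Inter>t\<in>T. blinfun_apply t -` ball (blinfun_apply t x) e)"
  have "openin weak_topology U"
    unfolding U_def using T(1)
    by (induction T) (auto intro!: openin_Int openin_weak_preimage simp del: vimage_Int simp: openin_topspace[of weak_topology, simplified])
  then have "openin (subtopology weak_topology C) (U \<inter> C)" by (auto simp: openin_subtopology)
  moreover have "x \<in> C" using assms(1) by (auto simp: in_closure_of)
  then have "x \<in> U \<inter> C" using T(2) by (auto simp: U_def)
  ultimately obtain a where "a \<in> A" "a \<in> U" using assms(1) unfolding in_closure_of by blast
  then have "\<forall>t\<in>T. \<bar>blinfun_apply t (a - x)\<bar> < e"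
    by (auto simp: U_def dist_real_def blinfun.diff_right abs_minus_commute)
  then show "\<exists>a\<in>A. \<forall>t\<in>T. \<bar>blinfun_apply t (a - x)\<bar> < e" using \<open>a \<in> A\<close> by blast
qed

text \<open>A form of the Banach-Alaoglu theorem: the dual unit ball is weak* compact.\<close>

lemma ultrafilter_limit_of_functionals:
  fixes t :: "'i \<Rightarrow> 'a::real_normed_vector \<Rightarrow>\<^sub>L real"
  assumes p: "ultrafilter p" and t: "\<And>i. norm (t i) \<le> 1"
  shows "\<exists>l :: 'a \<Rightarrow>\<^sub>L real. \<forall>x. ((\<lambda>i. blinfun_apply (t i) x) \<longlongrightarrow> blinfun_apply l x) p"
proof -
  note bot = ultrafilter_imp_not_bot[OF p]
  have b: "\<bar>blinfun_apply (t i) x\<bar> \<le> norm x" for i x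
    using norm_blinfun[of "t i" x] mult_right_mono[OF t[of i], of "norm x"] by simp
  have "\<forall>x. \<exists>L. ((\<lambda>i. blinfun_apply (t i) x) \<longlongrightarrow> L) p"
    by (intro allI ultrafilter_bounded_limit[OF p]) (rule b)
  then obtain L where L: "\<And>x. ((\<lambda>i. blinfun_apply (t i) x) \<longlongrightarrow> L x) p" by metis
  have "bounded_linear L"
  proof (rule bounded_linear_intro)
    fix x y show "L (x + y) = L x + L y"
      using tendsto_unique[OF bot L[of "x + y"]] tendsto_add[OF L[of x] L[of y]]
      by (simp add: blinfun.add_right)
  next
    fix a x show "L (a *\<^sub>R x) = a *\<^sub>R L x"
      using tendsto_unique[OF bot L[of "a *\<^sub>R x"]] tendsto_scaleR[OF tendsto_const L[of x], of a]
      by (simp add: blinfun.scaleR_right)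
  next
    fix x show "norm (L x) \<le> norm x * 1"
      using tendsto_upperbound[OF tendsto_rabs[OF L[of x]] always_eventually[OF allI[OF b]] bot] by simp
  qed
  then have "blinfun_apply (Blinfun L) = L" by (rule bounded_linear_Blinfun_apply)
  then show ?thesis using L by (intro exI[of _ "Blinfun L"]) simp
qed

text \<open>A compactness argument: if for each finite \<open>F \<subseteq> A\<close> some \<open>m\<close>-tuple in the dual ball were simultaneously small at no point
of \<open>F\<close>, then a weak* limit of these tuples along the finite subsets of \<open>A\<close> would be so at no point of \<open>A\<close>.\<close>

lemma finite_set_catching_tuples:
  fixes x :: "'a::real_normed_vector"
  assumes A: "weakly_adherent x A" and e: "e > 0"
  shows "\<exists>F\<subseteq>A. finite F \<and> (\<forall>\<tau> :: nat \<Rightarrow> 'a \<Rightarrow>\<^sub>L real. (\<forall>i. norm (\<tau> i) \<le> 1) \<longrightarrow>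
           (\<exists>a\<in>F. \<forall>i<m. \<bar>blinfun_apply (\<tau> i) (a - x)\<bar> < e))"
proof (rule ccontr)
  assume none: "\<not> ?thesis"
  have "\<exists>\<tau> :: nat \<Rightarrow> 'a \<Rightarrow>\<^sub>L real. (\<forall>i. norm (\<tau> i) \<le> 1) \<and>
       (F \<subseteq> A \<and> finite F \<longrightarrow> (\<forall>a\<in>F. \<exists>i<m. e \<le> \<bar>blinfun_apply (\<tau> i) (a - x)\<bar>))" for F
  proof (cases "F \<subseteq> A \<and> finite F")
    case True
    then show ?thesis using none by (meson not_le)
  next
    case False
    then show ?thesis by (intro exI[of _ "\<lambda>_. 0"]) auto
  qed
  then obtain \<tau> :: "'a set \<Rightarrow> nat \<Rightarrow> 'a \<Rightarrow>\<^sub>L real" where \<tau>: "\<And>F i. norm (\<tau> F i) \<le> 1"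
    "\<And>F a. F \<subseteq> A \<Longrightarrow> finite F \<Longrightarrow> a \<in> F \<Longrightarrow> \<exists>i<m. e \<le> \<bar>blinfun_apply (\<tau> F i) (a - x)\<bar>"
    by metis
  obtain p where p: "p \<le> finite_subsets_at_top A" "ultrafilter p"
    using ex_ultrafilter_le[of "finite_subsets_at_top A"] by auto
  have "\<forall>i. \<exists>l :: 'a \<Rightarrow>\<^sub>L real. \<forall>y. ((\<lambda>F. blinfun_apply (\<tau> F i) y) \<longlongrightarrow> blinfun_apply l y) p"
    by (intro allI ultrafilter_limit_of_functionals[OF p(2)] \<tau>(1))
  then obtain l :: "nat \<Rightarrow> 'a \<Rightarrow>\<^sub>L real"
    where l: "\<And>i y. ((\<lambda>F. blinfun_apply (\<tau> F i) y) \<longlongrightarrow> blinfun_apply (l i) y) p" by metis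
  obtain a where a: "a \<in> A" "\<And>i. i < m \<Longrightarrow> \<bar>blinfun_apply (l i) (a - x)\<bar> < e"
    using A[unfolded weakly_adherent_def, rule_format, of "l ` {..<m}" e] e by auto
  have "eventually (\<lambda>F. \<exists>i\<in>{..<m}. e \<le> \<bar>blinfun_apply (\<tau> F i) (a - x)\<bar>) p"
  proof (rule filter_leD[OF p(1)])
    show "eventually (\<lambda>F. \<exists>i\<in>{..<m}. e \<le> \<bar>blinfun_apply (\<tau> F i) (a - x)\<bar>) (finite_subsets_at_top A)"
      unfolding eventually_finite_subsets_at_top
      by (rule exI[of _ "{a}"]) (use a(1) \<tau>(2) in \<open>auto simp: Bex_def\<close>)
  qed
  from ultrafilter_eventually_bex_finite[OF p(2) finite_lessThan this]
  obtain i where i: "i < m" "eventually (\<lambda>F. e \<le> \<bar>blinfun_apply (\<tau> F i) (a - x)\<bar>) p"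
    by blast
  have "e \<le> \<bar>blinfun_apply (l i) (a - x)\<bar>"
    by (rule tendsto_lowerbound[OF tendsto_rabs[OF l] i(2) ultrafilter_imp_not_bot[OF p(2)]])
  then show False using a(2)[OF i(1)] by simp
qed

text \<open>Kaplansky's theorem: the union over \<open>m\<close> of finite sets that catch all \<open>m\<close>-tuples within \<open>1 / (m + 1)\<close> is
countable and still has \<open>x\<close> in its weak closure.\<close>

lemma weakly_adherent_countable:
  fixes x :: "'a::real_normed_vector"
  assumes A: "weakly_adherent x A"
  shows "\<exists>g :: nat \<Rightarrow> 'a. range g \<subseteq> A \<and> weakly_adherent x (range g)"
proof -
  have "\<forall>m. \<exists>F\<subseteq>A. finite F \<and> (\<forall>\<tau> :: nat \<Rightarrow> 'a \<Rightarrow>\<^sub>L real. (\<forall>i. norm (\<tau> i) \<le> 1) \<longrightarrow>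
           (\<exists>a\<in>F. \<forall>i<m. \<bar>blinfun_apply (\<tau> i) (a - x)\<bar> < inverse (real (Suc m))))"
    using finite_set_catching_tuples[OF A] by simp
  then obtain F where F: "\<And>m. F m \<subseteq> A" "\<And>m. finite (F m)"
    "\<And>m \<tau>. (\<And>i. norm (\<tau> i :: 'a \<Rightarrow>\<^sub>L real) \<le> 1) \<Longrightarrow>
       \<exists>a\<in>F m. \<forall>i<m. \<bar>blinfun_apply (\<tau> i) (a - x)\<bar> < inverse (real (Suc m))"
    by metis
  define A' where "A' = (\<Union>m. F m)"
  have "weakly_adherent x A'"
    unfolding weakly_adherent_def
  proof (intro allI impI)
    fix T :: "('a \<Rightarrow>\<^sub>L real) set" and e :: real assume T: "finite T" and e: "e > 0"
    obtain \<tau> :: "nat \<Rightarrow> 'a \<Rightarrow>\<^sub>L real" where \<tau>: "T = \<tau> ` {i. i < card T}"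
      using finite_imp_nat_seg_image_inj_on[OF T] by (metis (no_types) card_Collect_less_nat card_image)
    \<comment> \<open>Division by \<open>C\<close> moves the given functionals into the dual ball; the tuple is padded with zeros.\<close>
    define C where "C = 1 + (\<Sum>t\<in>T. norm t)"
    have C: "C > 0" "\<And>t. t \<in> T \<Longrightarrow> norm t \<le> C"
      using member_le_sum[OF _ _ T, of _ norm] sum_nonneg[of T norm] unfolding C_def by force+
    obtain k where k: "inverse (real (Suc k)) < e / C" using reals_Archimedean[of "e / C"] e C(1) by auto
    define m where "m = max k (card T)"
    define \<tau>' where "\<tau>' i = (if i < card T then (1 / C) *\<^sub>R \<tau> i else 0)" for i
    have "\<tau> i \<in> T" if "i < card T" for i using that \<tau> by blast
    then have "norm (\<tau>' i) \<le> 1" for i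
      using C by (auto simp: \<tau>'_def divide_le_eq)
    then have "\<exists>a\<in>F m. \<forall>i<m. \<bar>blinfun_apply (\<tau>' i) (a - x)\<bar> < inverse (real (Suc m))" by (rule F(3))
    then obtain a where
      a: "a \<in> F m" "\<And>i. i < m \<Longrightarrow> \<bar>blinfun_apply (\<tau>' i) (a - x)\<bar> < inverse (real (Suc m))" by auto
    have "inverse (real (Suc m)) \<le> inverse (real (Suc k))" by (simp add: m_def)
    then have small: "inverse (real (Suc m)) < e / C" using k by linarith
    have "\<bar>blinfun_apply t (a - x)\<bar> < e" if "t \<in> T" for t
    proof -
      have "t \<in> \<tau> ` {i. i < card T}" using that \<tau> by blast
      then obtain i where i: "i < card T" "t = \<tau> i" by blast
      then have "i < m" by (simp add: m_def)
      then have "\<bar>blinfun_apply (\<tau>' i) (a - x)\<bar> < e / C" using a(2) small less_trans by blast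
      then have "\<bar>blinfun_apply t (a - x)\<bar> / C < e / C"
        using i C(1) by (simp add: \<tau>'_def blinfun.scaleR_left abs_mult)
      then show ?thesis using C(1) by (simp add: divide_less_cancel)
    qed
    then show "\<exists>a\<in>A'. \<forall>t\<in>T. \<bar>blinfun_apply t (a - x)\<bar> < e" using a(1) by (auto simp: A'_def)
  qed
  moreover from this have "A' \<noteq> {}"
    unfolding weakly_adherent_def by (metis empty_iff finite.emptyI zero_less_one)
  moreover have "countable A'" unfolding A'_def using F(2) by (auto intro: countable_finite)
  moreover have "A' \<subseteq> A" using F(1) by (auto simp: A'_def)
  ultimately show ?thesis by (intro exI[of _ "from_nat_into A'"]) (simp add: range_from_nat_into)
qed

text \<open>Any ultrafilter finer than the pullback along \<open>g\<close> of the weak neighbourhoods of \<open>x\<close> will do.\<close>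

lemma ultrafilter_weakly_convergent:
  assumes "weakly_adherent x (range g)"
  shows "\<exists>p. ultrafilter p \<and> (\<forall>t :: 'a::real_normed_vector \<Rightarrow>\<^sub>L real. ((\<lambda>n. blinfun_apply t (g n - x)) \<longlongrightarrow> 0) p)"
proof -
  define F where "F = (INF z\<in>UNIV \<times> {0<..}. principal {n. \<bar>blinfun_apply (fst z :: 'a \<Rightarrow>\<^sub>L real) (g n - x)\<bar> < snd z})"
  have "F \<noteq> bot"
    unfolding F_def
  proof (rule INF_filter_not_bot)
    fix X :: "(('a \<Rightarrow>\<^sub>L real) \<times> real) set" assume X: "X \<subseteq> UNIV \<times> {0<..}" "finite X"
    define e where "e = Min (insert 1 (snd ` X))"
    have e: "e > 0" "\<And>z. z \<in> X \<Longrightarrow> e \<le> snd z" using X by (auto simp: e_def)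
    have "\<exists>a\<in>range g. \<forall>t\<in>fst ` X. \<bar>blinfun_apply t (a - x)\<bar> < e"
      using assms[unfolded weakly_adherent_def, rule_format, of "fst ` X" e] e X by simp
    then obtain n where "\<And>z. z \<in> X \<Longrightarrow> \<bar>blinfun_apply (fst z) (g n - x)\<bar> < e" by blast
    then have "n \<in> (\<Inter>z\<in>X. {n. \<bar>blinfun_apply (fst z) (g n - x)\<bar> < snd z})"
      using e(2) by fastforce
    then show "(INF z\<in>X. principal {n. \<bar>blinfun_apply (fst z) (g n - x)\<bar> < snd z}) \<noteq> bot"
      using X(2) by (auto simp: INF_principal_finite principal_eq_bot_iff)
  qed
  then obtain p where p: "p \<le> F" "ultrafilter p" using ex_ultrafilter_le by blast
  have "((\<lambda>n. blinfun_apply t (g n - x)) \<longlongrightarrow> 0) p" for t :: "'a \<Rightarrow>\<^sub>L real"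
  proof (rule tendstoI)
    fix e :: real assume "e > 0"
    then have "p \<le> principal {n. \<bar>blinfun_apply t (g n - x)\<bar> < e}"
      using p(1) unfolding F_def by (auto simp: le_INF_iff)
    then show "eventually (\<lambda>n. dist (blinfun_apply t (g n - x)) 0 < e) p"
      by (simp add: le_principal)
  qed
  then show ?thesis using p(2) by blast
qed

section \<open>A game on finite sequences\<close>

text \<open>The positions from which the player choosing sets in \<open>p\<close> can force the play to leave \<open>R\<close> after finitely many
rounds. Being inductive, the predicate records the determinacy of this open game: outside it, the opponent
always has a move that stays outside.\<close>

inductive forced_exit :: "'i filter \<Rightarrow> ('i list \<Rightarrow> bool) \<Rightarrow> 'i list \<Rightarrow> bool" for p R where
  out: "\<not> R s \<Longrightarrow> forced_exit p R s"
| move: "eventually (\<lambda>n. n \<in> U) p \<Longrightarrow> (\<And>n. n \<in> U \<Longrightarrow> forced_exit p R (s @ [n])) \<Longrightarrow> forced_exit p R s"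

lemma map_upt_Suc_Cons: "map m [0..<Suc k] = m 0 # map (\<lambda>i. m (Suc i)) [0..<k]"
  by (simp add: upt_conv_Cons map_Suc_upt[symmetric] comp_def del: upt_Suc)

text \<open>The inductive predicate unfolds to a strategy \<open>U\<close>, which maps the moves made since position \<open>s\<close> to the next set in \<open>p\<close>.\<close>

lemma forced_exit_strategy:
  assumes "forced_exit p R s"
  shows "\<exists>U. (\<forall>r. eventually (\<lambda>n. n \<in> U r) p) \<and>
    (\<forall>m :: nat \<Rightarrow> 'i. (\<forall>i. m i \<in> U (map m [0..<i])) \<longrightarrow> (\<exists>k. \<not> R (s @ map m [0..<k])))"
  using assms
proof induction
  case (out s)
  then show ?case by (intro exI[of _ "\<lambda>_. UNIV"]) (auto intro: exI[of _ 0])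
next
  case (move U s)
  then have "\<forall>n\<in>U. \<exists>V. (\<forall>r. eventually (\<lambda>n. n \<in> V r) p) \<and>
    (\<forall>m. (\<forall>i. m i \<in> V (map m [0..<i])) \<longrightarrow> (\<exists>k. \<not> R ((s @ [n]) @ map m [0..<k])))" by blast
  then obtain V where V: "\<And>n r. n \<in> U \<Longrightarrow> eventually (\<lambda>k. k \<in> V n r) p"
    "\<And>n m. n \<in> U \<Longrightarrow> (\<And>i. m i \<in> V n (map m [0..<i])) \<Longrightarrow> \<exists>k. \<not> R ((s @ [n]) @ map m [0..<k])"
    by metis
  define W where "W r = (case r of [] \<Rightarrow> U | n # r' \<Rightarrow> if n \<in> U then V n r' else UNIV)" for r
  have "eventually (\<lambda>n. n \<in> W r) p" for r
    using move(1) V(1) by (cases r) (auto simp: W_def)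
  moreover have "\<exists>k. \<not> R (s @ map m [0..<k])" if m: "\<And>i. m i \<in> W (map m [0..<i])" for m
  proof -
    have m0: "m 0 \<in> U" using m[of 0] by (simp add: W_def)
    have "m (Suc i) \<in> V (m 0) (map (\<lambda>i. m (Suc i)) [0..<i])" for i
      using m[of "Suc i"] m0 unfolding map_upt_Suc_Cons by (simp add: W_def)
    then obtain k where "\<not> R ((s @ [m 0]) @ map (\<lambda>i. m (Suc i)) [0..<k])"
      using V(2)[OF m0, of "\<lambda>i. m (Suc i)"] by blast
    then have "\<not> R (s @ map m [0..<Suc k])" unfolding map_upt_Suc_Cons by simp
    then show ?thesis by blast
  qed
  ultimately show ?case by (intro exI[of _ W]) blast
qed

text \<open>For an ultrafilter the surviving moves form a member of \<open>p\<close>, and members can be intersected; for a general filter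
one would only know that this set meets every member of it.\<close>

lemma not_forced_exit_extend:
  assumes "ultrafilter p" "\<not> forced_exit p R s"
  shows "eventually (\<lambda>n. \<not> forced_exit p R (s @ [n])) p"
proof (rule ccontr)
  assume "\<not> ?thesis"
  then have "eventually (\<lambda>n. n \<in> {n. forced_exit p R (s @ [n])}) p"
    using ultrafilter_eventually_not[OF assms(1)] by auto
  then have "forced_exit p R s" by (rule forced_exit.move) simp
  then show False using assms(2) by simp
qed

text \<open>Only finitely many positions use moves up to \<open>n\<close>, so one set in \<open>p\<close> serves all of them at once.\<close>

lemma eventually_all_positions:
  assumes "\<And>s. eventually (P s) p"
  shows "eventually (\<lambda>n'. \<forall>s. sorted_wrt (<) s \<and> set s \<subseteq> {..n::nat} \<longrightarrow> P s n') p"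
proof -
  have "finite {s. sorted_wrt (<) s \<and> set s \<subseteq> {..n}}"
    by (rule finite_subset[OF _ finite_subset_distinct[of "{..n}"]]) (auto simp: strict_sorted_iff)
  then have "eventually (\<lambda>n'. \<forall>s\<in>{s. sorted_wrt (<) s \<and> set s \<subseteq> {..n}}. P s n') p"
    using assms by (intro eventually_ball_finite ballI) auto
  then show ?thesis by (rule eventually_mono) auto
qed

lemma ex_chain:
  assumes "\<And>n. eventually (r n) p" and "p \<noteq> bot"
  shows "\<exists>c. c 0 = a \<and> (\<forall>i. r (c i) (c (Suc i)))"
proof -
  have "\<forall>n. \<exists>n'. r n n'" using assms eventually_happens' by blast
  then obtain f where f: "\<And>n. r n (f n)" by metis
  show ?thesis using f by (intro exI[of _ "\<lambda>i. (f ^^ i) a"]) simp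
qed

section \<open>Independence or convergence\<close>

definition alternates :: "real \<Rightarrow> ('i \<Rightarrow> real) \<Rightarrow> 'i list \<Rightarrow> bool" where
  "alternates e f s \<longleftrightarrow>
     (\<forall>i<length s. if even i then e \<le> f (s ! i) else f (s ! i) \<le> e / 2)"

text \<open>The entries \<open>3 * i + 1\<close> are the ones of interest. Each is put in an even or in an odd place, as \<open>P\<close> prescribes, by adding
one of its two neighbours as a filler.\<close>

lemma ex_pattern_indices:
  "\<exists>js. sorted_wrt (<) js \<and> length js = 2 * k \<and> set js \<subseteq> {..<3 * k} \<and>
     (\<forall>i<k. if i \<in> P then js ! (2 * i) = 3 * i + 1 else js ! Suc (2 * i) = 3 * i + 1)"
proof (induction k)
  case 0
  show ?case by simp
next
  case (Suc k)
  then obtain js where js: "sorted_wrt (<) js" "length js = 2 * k" "set js \<subseteq> {..<3 * k}"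
    "\<And>i. i < k \<Longrightarrow> if i \<in> P then js ! (2 * i) = 3 * i + 1 else js ! Suc (2 * i) = 3 * i + 1" by blast
  define b where "b = (if k \<in> P then 3 * k + 1 else 3 * k)"
  let ?js = "js @ [b, Suc b]"
  have "if i \<in> P then ?js ! (2 * i) = 3 * i + 1 else ?js ! Suc (2 * i) = 3 * i + 1" if "i < Suc k" for i
  proof (cases "i = k")
    case True
    then show ?thesis using js(2) by (simp add: nth_append b_def)
  next
    case False
    then show ?thesis using js(2) js(4)[of i] that by (simp add: nth_append)
  qed
  moreover have "sorted_wrt (<) ?js" using js(1,3) by (force simp: sorted_wrt_append b_def)
  moreover have "set ?js \<subseteq> {..<3 * Suc k}" using js(3) by (auto simp: b_def)
  ultimately show ?case using js(2) by (intro exI[of _ ?js]) simp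
qed

text \<open>The game is survived, so there is a sequence \<open>m\<close> all of whose finite subsequences are surviving positions: each new term is
chosen from the intersection of the members of \<open>p\<close> belonging to the finitely many earlier subsequences. Alternation along
suitable subsequences is independence of the terms \<open>m (3 * i + 1)\<close>.\<close>

lemma independent_if_not_forced_exit:
  fixes K :: "(nat \<Rightarrow> real) set"
  assumes p: "ultrafilter p" "p \<le> sequentially"
    and nf: "\<not> forced_exit p (\<lambda>s. \<exists>f\<in>K. alternates e f s) []"
  shows "\<exists>c :: nat \<Rightarrow> nat. \<forall>k P. \<exists>f\<in>K. \<forall>i<k. if i \<in> P then e \<le> f (c i) else f (c i) \<le> e / 2"
proof -
  let ?G = "\<lambda>s. \<not> forced_exit p (\<lambda>s. \<exists>f\<in>K. alternates e f s) s"
  define r where "r n n' \<longleftrightarrow> n < n' \<and>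
    (\<forall>s. sorted_wrt (<) s \<and> set s \<subseteq> {..n} \<longrightarrow> ?G s \<longrightarrow> ?G (s @ [n']))" for n n' :: nat
  have "eventually (r n) p" for n
    unfolding r_def
    by (intro eventually_conj eventually_all_positions filter_leD[OF p(2) eventually_gt_at_top])
      (use not_forced_exit_extend[OF p(1)] in \<open>auto intro: always_eventually\<close>)
  then obtain c where c: "\<And>i. r (c i) (c (Suc i))"
    using ex_chain[of r p 0] ultrafilter_imp_not_bot[OF p(1)] by blast
  then have mono: "strict_mono c" by (simp add: strict_mono_Suc_iff r_def)
  \<comment> \<open>The first term is dropped because \<open>r\<close> constrains only the successors in a chain.\<close>
  define m where "m i = c (Suc i)" for i
  have mono_m: "i < j \<Longrightarrow> m i < m j" for i j using mono by (simp add: m_def strict_mono_less)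
  have G: "?G (map m js)" if "sorted_wrt (<) js" for js
    using that
  proof (induction js rule: rev_induct)
    case Nil
    then show ?case using nf by simp
  next
    case (snoc j js)
    have "set (map m js) \<subseteq> {..c j}"
      using snoc.prems mono by (auto simp: sorted_wrt_append m_def strict_mono_less_eq)
    moreover have "sorted_wrt (<) (map m js)"
      using snoc.prems mono_m by (auto simp: sorted_wrt_append sorted_wrt_map intro: sorted_wrt_mono_rel[rotated])
    ultimately have "?G (map m js @ [m j])"
      using c[of j] snoc unfolding r_def m_def[symmetric] by (simp add: sorted_wrt_append)
    then show ?case by simp
  qed
  have "\<exists>f\<in>K. \<forall>i<k. if i \<in> P then e \<le> f (m (3 * i + 1)) else f (m (3 * i + 1)) \<le> e / 2" for k P
  proof -
    obtain js where js: "sorted_wrt (<) js" "length js = 2 * k"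
      "\<And>i. i < k \<Longrightarrow> if i \<in> P then js ! (2 * i) = 3 * i + 1 else js ! Suc (2 * i) = 3 * i + 1"
      using ex_pattern_indices[of k P] by blast
    have "\<exists>f\<in>K. alternates e f (map m js)"
      using G[OF js(1)] forced_exit.out[of "\<lambda>s. \<exists>f\<in>K. alternates e f s"] by blast
    then obtain f where f: "f \<in> K" "alternates e f (map m js)" by blast
    have "if i \<in> P then e \<le> f (m (3 * i + 1)) else f (m (3 * i + 1)) \<le> e / 2" if "i < k" for i
      using f(2)[unfolded alternates_def, rule_format, of "2 * i"]
        f(2)[unfolded alternates_def, rule_format, of "Suc (2 * i)"] js(2) js(3)[OF that] that
      by (auto split: if_splits)
    then show ?thesis using f(1) by blast
  qed
  then show ?thesis by (intro exI[of _ "\<lambda>i. m (3 * i + 1)"]) blast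
qed

text \<open>If \<open>r n n'\<close> holds, then \<open>n'\<close> obeys the strategies for \<open>\<epsilon> 0, \<dots>, \<epsilon> n\<close> at every position with moves up to \<open>n\<close>. Hence each
subsequence of an \<open>r\<close>-chain follows the strategy for \<open>\<epsilon> j\<close> as soon as its terms exceed \<open>j\<close>. Moreover \<open>r\<close> depends monotonically on \<open>n\<close>,
so terms of one chain may be interleaved with elements of sets in \<open>p\<close>; this compares the behaviour of \<open>f\<close> along the chain with
its limit \<open>0\<close> along \<open>p\<close>. Symmetry of \<open>K\<close> turns upper bounds for \<open>f\<close> into bounds for \<open>\<bar>f\<bar>\<close>.\<close>

lemma null_subsequence_if_forced_exit:
  fixes K :: "(nat \<Rightarrow> real) set"
  assumes p: "ultrafilter p" "p \<le> sequentially"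
    and null: "\<And>f. f \<in> K \<Longrightarrow> (f \<longlongrightarrow> 0) p" and sym: "\<And>f. f \<in> K \<Longrightarrow> (\<lambda>n. - f n) \<in> K"
    and forced: "\<And>e. e > 0 \<Longrightarrow> forced_exit p (\<lambda>s. \<exists>f\<in>K. alternates e f s) []"
  shows "\<exists>c :: nat \<Rightarrow> nat. \<forall>f\<in>K. (\<lambda>i. f (c i)) \<longlonglongrightarrow> 0"
proof -
  define \<epsilon> where "\<epsilon> j = inverse (real (Suc j))" for j
  have \<epsilon>: "\<epsilon> j > 0" for j by (simp add: \<epsilon>_def)
  have "\<forall>j. \<exists>U. (\<forall>r. eventually (\<lambda>n. n \<in> U r) p) \<and>
    (\<forall>m :: nat \<Rightarrow> nat. (\<forall>i. m i \<in> U (map m [0..<i])) \<longrightarrow>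
       (\<exists>k. \<not> (\<exists>f\<in>K. alternates (\<epsilon> j) f ([] @ map m [0..<k]))))"
    using forced_exit_strategy[OF forced[OF \<epsilon>]] by blast
  then obtain U where U: "\<And>j s. eventually (\<lambda>n. n \<in> U j s) p"
    and win: "\<And>j m. (\<And>i. m i \<in> U j (map m [0..<i])) \<Longrightarrow>
      \<exists>k. \<not> (\<exists>f\<in>K. alternates (\<epsilon> j) f (map m [0..<k]))"
    unfolding append_Nil by metis
  define r where "r n n' \<longleftrightarrow> n < n' \<and>
    (\<forall>j\<in>{..n}. \<forall>s. sorted_wrt (<) s \<and> set s \<subseteq> {..n} \<longrightarrow> n' \<in> U j s)" for n n' :: nat
  have ev: "eventually (r n) p" for n
    unfolding r_def
    by (intro eventually_conj eventually_ball_finite ballI finite_atMost eventually_all_positions U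
        filter_leD[OF p(2) eventually_gt_at_top])
  have r_mono: "r n' n''" if "n' \<le> n" "r n n''" for n n' n''
    using that unfolding r_def by (meson atMost_iff atMost_subset_iff order.trans order.strict_trans1)
  have no_alternation: False
    if c: "\<And>i. r (c i) (c (Suc i))" "j \<le> c 0" and f: "f \<in> K"
      "\<And>i. if even i then \<epsilon> j \<le> f (c (Suc i)) else f (c (Suc i)) \<le> \<epsilon> j / 2" for c j f
  proof -
    have mono: "strict_mono c" using c(1) by (simp add: strict_mono_Suc_iff r_def)
    \<comment> \<open>The play starts with \<open>c 1\<close>; the term \<open>c 0\<close> serves to make strategy \<open>j\<close> binding for it.\<close>
    let ?m = "\<lambda>i. c (Suc i)"
    have "?m i \<in> U j (map ?m [0..<i])" for i
    proof -
      have "sorted_wrt (<) (map ?m [0..<i])"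
        using mono by (simp add: sorted_wrt_map sorted_wrt_iff_nth_less strict_mono_less)
      moreover have "set (map ?m [0..<i]) \<subseteq> {..c i}"
        using mono by (auto simp: strict_mono_less_eq)
      moreover have "j \<le> c i" using c(2) mono by (meson le0 order.trans strict_mono_less_eq)
      ultimately show ?thesis using c(1)[of i] unfolding r_def by blast
    qed
    then have "\<exists>k. \<not> (\<exists>f\<in>K. alternates (\<epsilon> j) f (map ?m [0..<k]))" by (rule win)
    then obtain k where "\<not> alternates (\<epsilon> j) f (map ?m [0..<k])" using f(1) by blast
    moreover have "alternates (\<epsilon> j) f (map ?m [0..<k])"
      unfolding alternates_def
    proof (intro allI impI)
      fix i assume "i < length (map ?m [0..<k])"
      then have "map ?m [0..<k] ! i = c (Suc i)" by simp
      then show "if even i then \<epsilon> j \<le> f (map ?m [0..<k] ! i) else f (map ?m [0..<k] ! i) \<le> \<epsilon> j / 2"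
        using f(2)[of i] by presburger
    qed
    ultimately show False by simp
  qed
  note bot = ultrafilter_imp_not_bot[OF p(1)]
  obtain c where c: "\<And>i. r (c i) (c (Suc i))"
    using ex_chain[of r p 0, OF ev bot] by blast
  then have mono: "strict_mono c" by (simp add: strict_mono_Suc_iff r_def)
  have small: "eventually (\<lambda>i. f (c i) < \<epsilon> j) sequentially" if f: "f \<in> K" for f j
  proof (rule ccontr)
    assume "\<not> ?thesis"
    then have freq: "\<exists>i\<ge>k. \<epsilon> j \<le> f (c i)" for k
      unfolding eventually_sequentially by (meson not_le)
    \<comment> \<open>From any \<open>n\<close> a step leads to a large value of \<open>f\<close>, taken from the chain, and to a small one, taken from \<open>p\<close>.\<close>
    have up: "\<exists>n'. r n n' \<and> \<epsilon> j \<le> f n'" for n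
    proof -
      obtain i where i: "i \<ge> Suc n" "\<epsilon> j \<le> f (c i)" using freq by blast
      then obtain i' where i': "i = Suc i'" "n \<le> i'" by (cases i) auto
      have "n \<le> c i'" using i'(2) strict_mono_imp_increasing[OF mono, of i'] by linarith
      then have "r n (c i)" using r_mono c[of i'] i'(1) by blast
      then show ?thesis using i(2) by blast
    qed
    have down: "\<exists>n'. r n n' \<and> f n' \<le> \<epsilon> j / 2" for n
    proof -
      have "eventually (\<lambda>n. f n < \<epsilon> j / 2) p" by (rule order_tendstoD(2)[OF null[OF f]]) (use \<epsilon>[of j] in simp)
      from eventually_happens'[OF bot eventually_conj[OF ev[of n] this]]
      show ?thesis by force
    qed
    have "\<exists>d. \<forall>i. (i = 0 \<longrightarrow> d i = j) \<and> r (d i) (d (Suc i)) \<and>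
       (if even i then \<epsilon> j \<le> f (d (Suc i)) else f (d (Suc i)) \<le> \<epsilon> j / 2)"
    proof (rule dependent_nat_choice)
      show "\<exists>n'. (Suc i = 0 \<longrightarrow> n' = j) \<and> r n n' \<and> (if even i then \<epsilon> j \<le> f n' else f n' \<le> \<epsilon> j / 2)" for n i
        using up[of n] down[of n] by (cases "even i") auto
    qed simp
    then obtain d where d: "d 0 = j" "\<And>i. r (d i) (d (Suc i))"
      "\<And>i. if even i then \<epsilon> j \<le> f (d (Suc i)) else f (d (Suc i)) \<le> \<epsilon> j / 2" by metis
    show False by (rule no_alternation[OF d(2) _ f d(3)]) (simp add: d(1))
  qed
  have "(\<lambda>i. f (c i)) \<longlonglongrightarrow> 0" if f: "f \<in> K" for f
  proof (rule tendstoI)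
    fix e :: real assume "e > 0"
    then obtain j where "\<epsilon> j < e" unfolding \<epsilon>_def using reals_Archimedean by blast
    have "eventually (\<lambda>i. f (c i) < \<epsilon> j \<and> - f (c i) < \<epsilon> j) sequentially"
      using small[OF f] small[OF sym[OF f]] by (intro eventually_conj)
    then show "eventually (\<lambda>i. dist (f (c i)) 0 < e) sequentially"
      by (rule eventually_mono) (use \<open>\<epsilon> j < e\<close> in auto)
  qed
  then show ?thesis by blast
qed

section \<open>Independent sequences span l1\<close>

text \<open>The embedding sends a sequence of coefficients to the corresponding absolutely convergent series; the lower
estimate passes to infinite sums and makes the inverse Lipschitz.\<close>

lemma l1_copy_if_lower_estimate:
  fixes x :: "nat \<Rightarrow> 'a::banach"
  assumes bound: "\<And>i. norm (x i) \<le> B" and d: "d > 0"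
    and lower: "\<And>k a. d * (\<Sum>i<k. \<bar>a i\<bar>) \<le> norm (\<Sum>i<k. a i *\<^sub>R x i)"
  shows "contains_isomorphic_copy_l1 TYPE('a)"
proof -
  define T where "T c = (\<Sum>i. l1_nth c i *\<^sub>R x i)" for c
  have le: "norm (l1_nth c i *\<^sub>R x i) \<le> B * \<bar>l1_nth c i\<bar>" for c i
    using mult_left_mono[OF bound[of i], of "\<bar>l1_nth c i\<bar>"] by (simp add: mult.commute)
  have sB: "summable (\<lambda>i. B * \<bar>l1_nth c i\<bar>)" for c by (intro summable_mult summable_l1_nth)
  have sn: "summable (\<lambda>i. norm (l1_nth c i *\<^sub>R x i))" for c
    by (rule summable_comparison_test'[OF sB[of c], of 0]) (use le in simp)
  then have s: "summable (\<lambda>i. l1_nth c i *\<^sub>R x i)" for c by (rule summable_norm_cancel)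
  have lin: "linear T"
  proof (rule linearI)
    fix c c' show "T (c + c') = T c + T c'"
      unfolding T_def by (simp add: suminf_add[OF s s] plus_l1.rep_eq scaleR_add_left)
  next
    fix a c show "T (a *\<^sub>R c) = a *\<^sub>R T c"
      unfolding T_def by (simp add: suminf_scaleR_right[OF s] scaleR_l1.rep_eq)
  qed
  have "norm (T c) \<le> norm c * B" for c
  proof -
    have "norm (T c) \<le> (\<Sum>i. norm (l1_nth c i *\<^sub>R x i))" unfolding T_def by (rule summable_norm[OF sn])
    also have "\<dots> \<le> (\<Sum>i. B * \<bar>l1_nth c i\<bar>)" by (rule suminf_le[OF le sn sB])
    also have "\<dots> = norm c * B" by (simp add: norm_l1.rep_eq suminf_mult[OF summable_l1_nth])
    finally show ?thesis .
  qed
  then have "bounded_linear T" using lin by (intro bounded_linear_intro[of T B]) (auto simp: linear_add linear_scale)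
  then have contT: "continuous_on UNIV T" by (rule linear_continuous_on)
  have below: "d * norm c \<le> norm (T c)" for c
  proof (rule LIMSEQ_le)
    show "(\<lambda>k. d * (\<Sum>i<k. \<bar>l1_nth c i\<bar>)) \<longlonglongrightarrow> d * norm c"
      unfolding norm_l1.rep_eq by (intro tendsto_intros summable_LIMSEQ summable_l1_nth)
    show "(\<lambda>k. norm (\<Sum>i<k. l1_nth c i *\<^sub>R x i)) \<longlonglongrightarrow> norm (T c)"
      unfolding T_def by (intro tendsto_intros summable_LIMSEQ s)
  qed (use lower in blast)
  have "inj T"
  proof (rule injI)
    fix c c' assume "T c = T c'"
    then have "d * norm (c - c') \<le> 0" using below[of "c - c'"] lin by (simp add: linear_diff)
    then show "c = c'" using d by (simp add: mult_le_0_iff)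
  qed
  have "homeomorphism UNIV (range T) T (inv T)"
    unfolding homeomorphism_def
  proof (intro conjI ballI contT)
    have "(1 / d)-lipschitz_on (range T) (inv T)"
    proof (rule lipschitz_onI)
      fix y y' assume "y \<in> range T" "y' \<in> range T"
      then obtain c c' where "y = T c" "y' = T c'" by blast
      then show "dist (inv T y) (inv T y') \<le> 1 / d * dist y y'"
        using below[of "c - c'"] d \<open>inj T\<close> lin by (simp add: dist_norm linear_diff field_simps)
    qed (use d in simp)
    then show "continuous_on (range T) (inv T)" by (rule lipschitz_on_continuous_on)
  qed (use \<open>inj T\<close> in \<open>auto simp: image_image f_inv_into_f\<close>)
  then show ?thesis using lin unfolding contains_isomorphic_copy_l1_def by blast
qed

text \<open>Choose \<open>t\<close> for the set of positive coefficients and \<open>u\<close> for its complement. Then \<open>t - u\<close> has norm at most \<open>2\<close>, and its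
value at \<open>x i\<close> has modulus at least \<open>e / 2\<close> and the sign of the \<open>i\<close>-th coefficient.\<close>

lemma l1_copy_if_independent:
  fixes x :: "nat \<Rightarrow> 'a::banach"
  assumes bound: "\<And>i. norm (x i) \<le> B" and e: "e > 0"
    and indep: "\<And>k P. \<exists>t :: 'a \<Rightarrow>\<^sub>L real. norm t \<le> 1 \<and>
      (\<forall>i<k. if i \<in> P then e \<le> blinfun_apply t (x i) else blinfun_apply t (x i) \<le> e / 2)"
  shows "contains_isomorphic_copy_l1 TYPE('a)"
proof (rule l1_copy_if_lower_estimate[OF bound])
  show "e / 4 > 0" using e by simp
next
  fix k and a :: "nat \<Rightarrow> real"
  obtain t :: "'a \<Rightarrow>\<^sub>L real" where t: "norm t \<le> 1"
    "\<And>i. i < k \<Longrightarrow> if a i > 0 then e \<le> blinfun_apply t (x i) else blinfun_apply t (x i) \<le> e / 2"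
    using indep[of k "{i. a i > 0}"] by auto
  obtain u :: "'a \<Rightarrow>\<^sub>L real" where u: "norm u \<le> 1"
    "\<And>i. i < k \<Longrightarrow> if a i \<le> 0 then e \<le> blinfun_apply u (x i) else blinfun_apply u (x i) \<le> e / 2"
    using indep[of k "{i. a i \<le> 0}"] by auto
  have summand: "e / 2 * \<bar>a i\<bar> \<le> a i * blinfun_apply (t - u) (x i)" if "i < k" for i
  proof (cases "a i > 0")
    case True
    then have "e / 2 \<le> blinfun_apply (t - u) (x i)"
      using t(2)[OF that] u(2)[OF that] by (simp add: blinfun.diff_left)
    then show ?thesis using True by (simp add: mult.commute mult_left_mono)
  next
    case False
    then have "e / 2 \<le> - blinfun_apply (t - u) (x i)"
      using t(2)[OF that] u(2)[OF that] by (simp add: blinfun.diff_left)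
    then have "- a i * (e / 2) \<le> - a i * - blinfun_apply (t - u) (x i)"
      using False by (intro mult_left_mono) auto
    then show ?thesis using False by (simp add: mult.commute)
  qed
  have "e / 2 * (\<Sum>i<k. \<bar>a i\<bar>) \<le> blinfun_apply (t - u) (\<Sum>i<k. a i *\<^sub>R x i)"
    unfolding blinfun.sum_right blinfun.scaleR_right sum_distrib_left real_scaleR_def
    by (intro sum_mono summand) simp
  also have "\<dots> \<le> norm (t - u) * norm (\<Sum>i<k. a i *\<^sub>R x i)"
    using norm_blinfun[of "t - u"] by (metis abs_le_D1 real_norm_def)
  also have "\<dots> \<le> 2 * norm (\<Sum>i<k. a i *\<^sub>R x i)"
    using norm_triangle_ineq4[of t u] t(1) u(1) by (intro mult_right_mono) auto
  finally show "e / 4 * (\<Sum>i<k. \<bar>a i\<bar>) \<le> norm (\<Sum>i<k. a i *\<^sub>R x i)" by simp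
qed

section \<open>Weakly convergent sequences in spaces without l1\<close>

text \<open>A principal ultrafilter at \<open>k\<close> would give \<open>t (h k) = 0\<close> for every functional \<open>t\<close>.\<close>

lemma weakly_null_ultrafilter_le_sequentially:
  fixes h :: "nat \<Rightarrow> 'a::real_normed_vector"
  assumes p: "ultrafilter p" and nz: "\<And>n. h n \<noteq> 0"
    and lim: "\<And>t :: 'a \<Rightarrow>\<^sub>L real. ((\<lambda>n. blinfun_apply t (h n)) \<longlongrightarrow> 0) p"
  shows "p \<le> sequentially"
proof -
  have "eventually (\<lambda>n. n \<noteq> k) p" for k
  proof (rule ccontr)
    assume "\<not> ?thesis"
    then have k: "eventually (\<lambda>n. n = k) p"
      using ultrafilter_eventually_not[OF p, of "\<lambda>n. n = k"] by simp
    obtain t :: "'a \<Rightarrow>\<^sub>L real" where t: "blinfun_apply t (h k) \<noteq> 0"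
      using functional_nonzero_at[OF nz] by blast
    have "((\<lambda>n. blinfun_apply t (h n)) \<longlongrightarrow> blinfun_apply t (h k)) p"
      by (rule tendsto_eventually) (use k in \<open>auto elim: eventually_mono\<close>)
    then show False using tendsto_unique[OF ultrafilter_imp_not_bot[OF p] lim[of t]] t by metis
  qed
  then have "eventually (\<lambda>n. \<forall>k\<in>{..<N}. n \<noteq> k) p" for N
    by (intro eventually_ball_finite) auto
  then have "eventually (\<lambda>n. N \<le> n) p" for N
    by (rule eventually_mono) (use not_le in auto)
  then show ?thesis
    unfolding le_filter_def eventually_sequentially by (metis (mono_tags, lifting) eventually_mono)
qed

text \<open>The dichotomy for the dual unit ball \<open>K\<close>, viewed as a set of real sequences by evaluation at the \<open>h n\<close>.\<close>

lemma weakly_null_subsequence_or_l1_copy: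
  fixes h :: "nat \<Rightarrow> 'a::banach"
  assumes p: "ultrafilter p" "p \<le> sequentially"
    and lim: "\<And>t :: 'a \<Rightarrow>\<^sub>L real. ((\<lambda>n. blinfun_apply t (h n)) \<longlongrightarrow> 0) p"
    and bound: "\<And>n. norm (h n) \<le> B"
    and no_l1: "\<not> contains_isomorphic_copy_l1 TYPE('a)"
  shows "\<exists>c :: nat \<Rightarrow> nat. \<forall>t :: 'a \<Rightarrow>\<^sub>L real. (\<lambda>i. blinfun_apply t (h (c i))) \<longlonglongrightarrow> 0"
proof -
  define K where "K = {(\<lambda>n. blinfun_apply t (h n)) | t :: 'a \<Rightarrow>\<^sub>L real. norm t \<le> 1}"
  have "\<exists>c. \<forall>f\<in>K. (\<lambda>i. f (c i)) \<longlonglongrightarrow> 0"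
  proof (rule null_subsequence_if_forced_exit[OF p])
    show "(f \<longlongrightarrow> 0) p" if "f \<in> K" for f using that lim by (auto simp: K_def)
    show "(\<lambda>n. - f n) \<in> K" if f: "f \<in> K" for f
    proof -
      obtain t :: "'a \<Rightarrow>\<^sub>L real" where t: "f = (\<lambda>n. blinfun_apply t (h n))" "norm t \<le> 1"
        using f by (auto simp: K_def)
      then show ?thesis unfolding K_def by (intro CollectI exI[of _ "- t"]) (simp add: blinfun.minus_left)
    qed
  next
    fix e :: real assume e: "e > 0"
    show "forced_exit p (\<lambda>s. \<exists>f\<in>K. alternates e f s) []"
    proof (rule ccontr)
      assume "\<not> ?thesis"
      from independent_if_not_forced_exit[OF p this] obtain c :: "nat \<Rightarrow> nat" where
        c: "\<And>k P. \<exists>f\<in>K. \<forall>i<k. if i \<in> P then e \<le> f (c i) else f (c i) \<le> e / 2" by blast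
      have "\<exists>t :: 'a \<Rightarrow>\<^sub>L real. norm t \<le> 1 \<and>
          (\<forall>i<k. if i \<in> P then e \<le> blinfun_apply t (h (c i)) else blinfun_apply t (h (c i)) \<le> e / 2)" for k P
        using c[of k P] unfolding K_def by blast
      from l1_copy_if_independent[OF bound e this] show False using no_l1 by simp
    qed
  qed
  then obtain c where c: "\<And>f. f \<in> K \<Longrightarrow> (\<lambda>i. f (c i)) \<longlonglongrightarrow> 0" by blast
  have "(\<lambda>i. blinfun_apply t (h (c i))) \<longlonglongrightarrow> 0" for t :: "'a \<Rightarrow>\<^sub>L real"
  proof -
    define k where "k = 1 + norm t"
    have k: "k > 0" by (simp add: k_def add_pos_nonneg)
    have "norm ((1 / k) *\<^sub>R t) \<le> 1" using k by (simp add: divide_le_eq) (simp add: k_def)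
    then have "(\<lambda>n. blinfun_apply ((1 / k) *\<^sub>R t) (h n)) \<in> K" unfolding K_def by blast
    from tendsto_mult_left[OF c[OF this], of k] show ?thesis
      using k by (simp add: blinfun.scaleR_left)
  qed
  then show ?thesis by blast
qed

lemma weakly_convergent_sequence_in_closure:
  fixes x :: "'a::banach"
  assumes no_l1: "\<not> contains_isomorphic_copy_l1 TYPE('a)"
    and A: "bounded A" "x \<notin> A" "weakly_adherent x A"
  shows "\<exists>y :: nat \<Rightarrow> 'a. range y \<subseteq> A \<and>
    (\<forall>t :: 'a \<Rightarrow>\<^sub>L real. (\<lambda>i. blinfun_apply t (y i)) \<longlonglongrightarrow> blinfun_apply t x)"
proof -
  obtain g :: "nat \<Rightarrow> 'a" where g: "range g \<subseteq> A" "weakly_adherent x (range g)"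
    using weakly_adherent_countable[OF A(3)] by blast
  obtain p where p: "ultrafilter p"
    and lim: "\<And>t :: 'a \<Rightarrow>\<^sub>L real. ((\<lambda>n. blinfun_apply t (g n - x)) \<longlongrightarrow> 0) p"
    using ultrafilter_weakly_convergent[OF g(2)] by blast
  have "g n - x \<noteq> 0" for n using g(1) A(2) by auto
  note p_le = weakly_null_ultrafilter_le_sequentially[OF p this lim]
  obtain B where "\<And>a. a \<in> A \<Longrightarrow> norm a \<le> B" using A(1) by (auto simp: bounded_iff)
  then have "norm (g n - x) \<le> B + norm x" for n
    using norm_triangle_ineq4[of "g n" x] g(1) by (meson add_mono order.refl order.trans rangeI subsetD)
  from weakly_null_subsequence_or_l1_copy[OF p p_le lim this no_l1]
  obtain c where c: "\<And>t :: 'a \<Rightarrow>\<^sub>L real. (\<lambda>i. blinfun_apply t (g (c i) - x)) \<longlonglongrightarrow> 0" by blast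
  have "(\<lambda>i. blinfun_apply t (g (c i))) \<longlonglongrightarrow> blinfun_apply t x" for t :: "'a \<Rightarrow>\<^sub>L real"
    using c[of t] by (simp add: blinfun.diff_right LIM_zero_iff)
  then show ?thesis using g(1) by (intro exI[of _ "g \<circ> c"]) auto
qed

text \<open>The tails of a sequence in \<open>A\<close> converging weakly to \<open>x\<close> form a Pytkeev sequence. They are infinite: a value attained
infinitely often would not be separated from \<open>x\<close> by any functional.\<close>

lemma Pytkeev_if_no_l1:
  assumes no_l1: "\<not> contains_isomorphic_copy_l1 TYPE('a::banach)"
  shows "Pytkeev_space (subtopology (weak_topology :: 'a topology) (cball 0 1))"
  unfolding Pytkeev_space_def
proof (intro allI impI)
  let ?X = "subtopology (weak_topology :: 'a topology) (cball 0 1)"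
  fix A :: "'a set" and x
  assume A: "A \<subseteq> topspace ?X" and x: "x \<in> ?X closure_of A - A"
  have A_ball: "A \<subseteq> cball 0 1" using A by simp
  then have "bounded A" by (rule bounded_subset[OF bounded_cball])
  moreover have "weakly_adherent x A" using weakly_adherent_if_in_closure x A_ball by blast
  ultimately obtain y where y: "range y \<subseteq> A"
    and lim: "\<And>t :: 'a \<Rightarrow>\<^sub>L real. (\<lambda>i. blinfun_apply t (y i)) \<longlonglongrightarrow> blinfun_apply t x"
    using weakly_convergent_sequence_in_closure[OF no_l1] x by (metis DiffD2)
  define Bs where "Bs n = y ` {n..}" for n
  have "infinite (Bs n)" for n
  proof
    assume "finite (Bs n)"
    then obtain i where i: "i \<in> {n..}" "infinite {j \<in> {n..}. y j = y i}"
      using pigeonhole_infinite[of "{n..}" y] infinite_Ici unfolding Bs_def by blast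
    have "y i - x \<noteq> 0" using x y by auto
    then obtain t :: "'a \<Rightarrow>\<^sub>L real" where t: "blinfun_apply t (y i - x) \<noteq> 0"
      using functional_nonzero_at by blast
    have "eventually (\<lambda>j. blinfun_apply t (y j) \<noteq> blinfun_apply t (y i)) sequentially"
      using lim[of t] t by (intro tendsto_imp_eventually_ne) (auto simp: blinfun.diff_right)
    then have "finite {j. blinfun_apply t (y j) = blinfun_apply t (y i)}"
      by (simp add: eventually_cofinite flip: cofinite_eq_sequentially)
    then have "finite {j \<in> {n..}. y j = y i}" by (rule rev_finite_subset) auto
    then show False using i(2) by simp
  qed
  moreover have "Bs n \<subseteq> A" for n using y by (auto simp: Bs_def)
  moreover have "\<exists>n. Bs n \<subseteq> N" if "openin ?X U" "x \<in> U" "U \<subseteq> N" for U N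
  proof -
    obtain V where V: "openin weak_topology V" "U = V \<inter> cball 0 1"
      using \<open>openin ?X U\<close> by (auto simp: openin_subtopology)
    have "eventually (\<lambda>i. y i \<in> V) sequentially"
      by (rule eventually_weak_nbhd[OF lim V(1)]) (use V(2) \<open>x \<in> U\<close> in blast)
    then obtain n where "\<And>i. i \<ge> n \<Longrightarrow> y i \<in> V" by (auto simp: eventually_sequentially)
    then have "Bs n \<subseteq> U" using y A_ball V(2) by (auto simp: Bs_def)
    then show ?thesis using \<open>U \<subseteq> N\<close> by blast
  qed
  ultimately show "\<exists>B :: nat \<Rightarrow> 'a set. (\<forall>n. infinite (B n) \<and> B n \<subseteq> A) \<and>
      (\<forall>N\<subseteq>topspace ?X. (\<exists>U. openin ?X U \<and> x \<in> U \<and> U \<subseteq> N) \<longrightarrow> (\<exists>n. B n \<subseteq> N))"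
    by (intro exI[of _ Bs] conjI allI impI) auto
qed

section \<open>The characterization\<close>

theorem theorem1p6:
  shows "Pytkeev_space (subtopology (weak_topology :: 'a::banach topology) (cball 0 1))
           \<longleftrightarrow> \<not> contains_isomorphic_copy_l1 TYPE('a)"
  using Pytkeev_if_no_l1 not_Pytkeev_if_l1 by blast

end
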